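(* Let $P$ be a set of $n$ points $p_1,\dots,p_n\in\{0,1\}^d$, let $\ell$ be a positive integer smaller than $n$, and let $\epsilon\in(0,1/2)$. Then the procedure $\mathrm{DIMREDHAMCENTER}(\ell,P,\epsilon/5)$ (described in the context) runs in time $O(n\log n\,(d+\ell)/\epsilon^2)$ and w.h.p. returns a set $T\subseteq P$ of $\ell$ centers with $\max_{v\in P}\min_{u\in T}\mathrm{ham}(v,u)\le(2+\epsilon)\cdot\mathrm{OPT}_{\mathrm{center}}$. Moreover, w.h.p. the partition of $P$ into $\ell$ clusters obtained by assigning every point $p_j\in P$ to a center $p_i\in T$ minimizing $W_{ij}$ (ties broken arbitrarily) has maximum cluster diameter (in Hamming distance) at most $(2+\epsilon)\cdot\mathrm{OPT}_{\mathrm{diam}}$.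
   Context: For $a,b\in\mathbb{R}^d$, $\mathrm{ham}(a,b)$ is the number of coordinates in which $a$ and $b$ differ (the Hamming distance). The $\ell$-center clustering problem in the Hamming space: given $P\subset\{0,1\}^d$, find a set $T$ of $\ell$ points of $\mathbb{R}^d$ minimizing $\max_{v\in P}\min_{u\in T}\mathrm{ham}(v,u)$; the optimum value is $\mathrm{OPT}_{\mathrm{center}}$. The minimum-diameter $\ell$-clustering problem: find a partition of $P$ into $\ell$ subsets $P_1,\dots,P_\ell$ minimizing $\max_i\max_{u,v\in P_i}\mathrm{ham}(u,v)$; the optimum value is $\mathrm{OPT}_{\mathrm{diam}}$. Procedure $\mathrm{DIMREDHAMCENTER}(\ell,P,\delta)$ with $\delta\in(0,1/2)$: set $k=\lceil c\log n/\delta^2\rceil$ for a suitably large absolute constant $c$ (e.g. $k\ge\frac{4+2\beta}{\delta^2/2-\delta^3/3}\ln n$); generate a random $k\times d$ matrix $R$ whose entries are independently $+1$ or $-1$ with probability $1/2$ each, and let $f(x)=\frac{1}{\sqrt k}Rx$; compute $f(p_i)$ for all $i$; for $i,j\in[n]$ let $W_{ij}=\|f(p_i)-f(p_j)\|_2^2$. Start with $T=\{p_1\}$ and, while $|T|<\ell$, add to $T$ a point $p_m\in P\setminus T$ maximizing $\min_{p_q\in T}W_{qm}$ (maintaining for each point its current minimum $W$-value to $T$). Return $T$. W.h.p. means with probability at least $1-1/n^{\beta}$ for any desired constant $\beta\ge1$ (with $c$ depending on $\beta$). Running times are in the real RAM model. *)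

theory Defs
  imports
    "HOL-Probability.Product_PMF"
    "HOL-Library.Disjoint_Sets"
    "Jordan_Normal_Form.Matrix"
begin

section \<open>Clustering in the Hamming space\<close>

definition ham :: "real vec \<Rightarrow> real vec \<Rightarrow> nat" where
  "ham a b = card {i. i < dim_vec a \<and> vec_index a i \<noteq> vec_index b i}"

definition hypercube :: "nat \<Rightarrow> real vec set" where
  "hypercube d = {x \<in> carrier_vec d. \<forall>i<d. vec_index x i \<in> {0, 1}}"

definition center_cost :: "real vec set \<Rightarrow> real vec set \<Rightarrow> nat" where
  "center_cost P T = Max ((\<lambda>v. Min ((\<lambda>u. ham v u) ` T)) ` P)"

text \<open>The infimum of a nonempty set of natural numbers is its minimum, so both optima below are
  attained. The centers range over all of \<open>\<real>\<^sup>d\<close>, not only over the hypercube.\<close>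

definition opt_center :: "nat \<Rightarrow> nat \<Rightarrow> real vec set \<Rightarrow> nat" where
  "opt_center d l P = (INF T\<in>{T. T \<subseteq> carrier_vec d \<and> card T = l}. center_cost P T)"

definition cluster_diameter :: "real vec set \<Rightarrow> nat" where
  "cluster_diameter C = Max ((\<lambda>(u, v). ham u v) ` (C \<times> C))"

definition max_diameter :: "real vec set set \<Rightarrow> nat" where
  "max_diameter Q = Max (cluster_diameter ` Q)"

definition opt_diam :: "nat \<Rightarrow> real vec set \<Rightarrow> nat" where
  "opt_diam l P = (INF Q\<in>{Q. partition_on P Q \<and> card Q = l}. max_diameter Q)"


section \<open>The procedure\<close>

text \<open>Points are indexed from \<open>0\<close>: the input is \<open>p 0, \<dots>, p (n - 1)\<close>.\<close>

definition target_dim :: "real \<Rightarrow> nat \<Rightarrow> real \<Rightarrow> nat" where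
  "target_dim c n \<delta> = nat \<lceil>c * ln (real n) / \<delta>\<^sup>2\<rceil>"

definition random_sign_matrix :: "nat \<Rightarrow> nat \<Rightarrow> real mat pmf" where
  "random_sign_matrix k d =
     map_pmf (mat k d) (Pi_pmf ({..<k} \<times> {..<d}) 0 (\<lambda>_. pmf_of_set {- 1, 1}))"

definition proj :: "real mat \<Rightarrow> real vec \<Rightarrow> real vec" where
  "proj R x = (1 / sqrt (real (dim_row R))) \<cdot>\<^sub>v (R *\<^sub>v x)"

definition W :: "real mat \<Rightarrow> (nat \<Rightarrow> real vec) \<Rightarrow> nat \<Rightarrow> nat \<Rightarrow> real" where
  "W R p i j = (let z = proj R (p i) - proj R (p j) in scalar_prod z z)"

text \<open>The index sets reachable by the farthest-point rule with the weights \<open>w\<close>; ties between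
  maximizers may be broken in any way.\<close>

inductive greedy_set :: "(nat \<Rightarrow> nat \<Rightarrow> real) \<Rightarrow> nat \<Rightarrow> nat set \<Rightarrow> bool"
  for w :: "nat \<Rightarrow> nat \<Rightarrow> real" and n :: nat where
  start: "greedy_set w n {0}"
| add: "greedy_set w n (insert m T)"
  if "greedy_set w n T"
    and "m \<in> {..<n} - T"
    and "\<forall>m'\<in>{..<n} - T. Min ((\<lambda>q. w q m') ` T) \<le> Min ((\<lambda>q. w q m) ` T)"

text \<open>All index sets that \<open>DIMREDHAMCENTER\<close> may return once the random matrix is \<open>R\<close>.\<close>

definition dimred_outputs :: "nat \<Rightarrow> nat \<Rightarrow> (nat \<Rightarrow> real vec) \<Rightarrow> real mat \<Rightarrow> nat set set" where
  "dimred_outputs n l p R = {T. greedy_set (W R p) n T \<and> card T = l}"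

definition nearest_assignment ::
  "nat \<Rightarrow> (nat \<Rightarrow> real vec) \<Rightarrow> real mat \<Rightarrow> nat set \<Rightarrow> (nat \<Rightarrow> nat) \<Rightarrow> bool" where
  "nearest_assignment n p R T a \<longleftrightarrow>
     (\<forall>j<n. a j \<in> T \<and> (\<forall>i\<in>T. W R p (a j) j \<le> W R p i j))"

definition clusters ::
  "nat \<Rightarrow> (nat \<Rightarrow> real vec) \<Rightarrow> nat set \<Rightarrow> (nat \<Rightarrow> nat) \<Rightarrow> real vec set set" where
  "clusters n p T a = (\<lambda>i. p ` {j. j < n \<and> a j = i}) ` T"


section \<open>The real RAM\<close>

text \<open>
  Structured programs over a real RAM in the sense of Preparata and Shamos: unit-cost exact real
  arithmetic including square roots and logarithms, comparisons and indirect addressing, together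
  with integer index arithmetic and a unit-cost fair coin. Reals cannot be rounded. Memory
  consists of named arrays; a scalar variable is cell \<open>0\<close> of the array of its name. Names of
  natural-number arrays and of real arrays live in separate name spaces.

  The coin outcomes are part of the state: \<open>Flip\<close> consumes the next one, and a program is stuck
  if it asks for more outcomes than are supplied.
\<close>

datatype nexp =
    NatC nat
  | NVar string nexp
  | NAdd nexp nexp
  | NMul nexp nexp

datatype rexp =
    RealC real
  | RVar string nexp
  | OfNat nexp
  | RAdd rexp rexp
  | RSub rexp rexp
  | RMul rexp rexp
  | RDiv rexp rexp
  | RSqrt rexp
  | RLn rexp

datatype bexp =
    NLess nexp nexp
  | RLess rexp rexp

datatype com =
    Skip
  | NAssign string nexp nexp
  | RAssign string nexp rexp
  | Flip string nexp
  | Seq com com  (infixr ";;" 60)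
  | If bexp com com
  | While bexp com

record state =
  nmem :: "string \<Rightarrow> nat \<Rightarrow> nat"
  rmem :: "string \<Rightarrow> nat \<Rightarrow> real"
  coins :: "real list"

primrec nval :: "nexp \<Rightarrow> state \<Rightarrow> nat" where
  "nval (NatC m) s = m"
| "nval (NVar x a) s = nmem s x (nval a s)"
| "nval (NAdd a b) s = nval a s + nval b s"
| "nval (NMul a b) s = nval a s * nval b s"

primrec rval :: "rexp \<Rightarrow> state \<Rightarrow> real" where
  "rval (RealC r) s = r"
| "rval (RVar x a) s = rmem s x (nval a s)"
| "rval (OfNat a) s = real (nval a s)"
| "rval (RAdd e f) s = rval e s + rval f s"
| "rval (RSub e f) s = rval e s - rval f s"
| "rval (RMul e f) s = rval e s * rval f s"
| "rval (RDiv e f) s = rval e s / rval f s"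
| "rval (RSqrt e) s = sqrt (rval e s)"
| "rval (RLn e) s = ln (rval e s)"

primrec bval :: "bexp \<Rightarrow> state \<Rightarrow> bool" where
  "bval (NLess a b) s \<longleftrightarrow> nval a s < nval b s"
| "bval (RLess e f) s \<longleftrightarrow> rval e s < rval f s"

text \<open>Every constant, memory access, arithmetic operation and comparison costs one step.\<close>

primrec ncost :: "nexp \<Rightarrow> nat" where
  "ncost (NatC m) = 1"
| "ncost (NVar x a) = 1 + ncost a"
| "ncost (NAdd a b) = 1 + ncost a + ncost b"
| "ncost (NMul a b) = 1 + ncost a + ncost b"

primrec rcost :: "rexp \<Rightarrow> nat" where
  "rcost (RealC r) = 1"
| "rcost (RVar x a) = 1 + ncost a"
| "rcost (OfNat a) = 1 + ncost a"
| "rcost (RAdd e f) = 1 + rcost e + rcost f"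
| "rcost (RSub e f) = 1 + rcost e + rcost f"
| "rcost (RMul e f) = 1 + rcost e + rcost f"
| "rcost (RDiv e f) = 1 + rcost e + rcost f"
| "rcost (RSqrt e) = 1 + rcost e"
| "rcost (RLn e) = 1 + rcost e"

primrec bcost :: "bexp \<Rightarrow> nat" where
  "bcost (NLess a b) = 1 + ncost a + ncost b"
| "bcost (RLess e f) = 1 + rcost e + rcost f"

definition nset :: "string \<Rightarrow> nat \<Rightarrow> nat \<Rightarrow> state \<Rightarrow> state" where
  "nset x i v s = s\<lparr>nmem := (nmem s)(x := (nmem s x)(i := v))\<rparr>"

definition rset :: "string \<Rightarrow> nat \<Rightarrow> real \<Rightarrow> state \<Rightarrow> state" where
  "rset x i v s = s\<lparr>rmem := (rmem s)(x := (rmem s x)(i := v))\<rparr>"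

text \<open>\<open>big_step c s t s'\<close>: started in \<open>s\<close>, the program \<open>c\<close> halts in \<open>s'\<close> after exactly \<open>t\<close> steps.\<close>

inductive big_step :: "com \<Rightarrow> state \<Rightarrow> nat \<Rightarrow> state \<Rightarrow> bool" where
  Skip: "big_step Skip s 1 s"
| NAssign: "big_step (NAssign x i a) s (1 + ncost i + ncost a) (nset x (nval i s) (nval a s) s)"
| RAssign: "big_step (RAssign x i e) s (1 + ncost i + rcost e) (rset x (nval i s) (rval e s) s)"
| Flip: "big_step (Flip x i) s (1 + ncost i) (rset x (nval i s) b (s\<lparr>coins := bs\<rparr>))"
  if "coins s = b # bs"
| Seq: "big_step (c1 ;; c2) s (t1 + t2) s''"
  if "big_step c1 s t1 s'" and "big_step c2 s' t2 s''"
| IfTrue: "big_step (If b c1 c2) s (1 + bcost b + t) s'"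
  if "bval b s" and "big_step c1 s t s'"
| IfFalse: "big_step (If b c1 c2) s (1 + bcost b + t) s'"
  if "\<not> bval b s" and "big_step c2 s t s'"
| WhileFalse: "big_step (While b c) s (1 + bcost b) s"
  if "\<not> bval b s"
| WhileTrue: "big_step (While b c) s (1 + bcost b + t1 + t2) s''"
  if "bval b s" and "big_step c s t1 s'" and "big_step (While b c) s' t2 s''"

lemma big_step_deterministic:
  "big_step c s t s' \<Longrightarrow> big_step c s u s'' \<Longrightarrow> u = t \<and> s'' = s'"
proof (induction arbitrary: u s'' rule: big_step.induct)
  case (Flip s b bs x i)
  from Flip.prems Flip.hyps show ?case by (cases rule: big_step.cases) auto
next
  case (Seq c1 s t1 s1 c2 t2 s2)
  from Seq.prems show ?case
    by (cases rule: big_step.cases) (use Seq.IH in blast)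
next
  case (IfTrue b s c1 t s' c2)
  from IfTrue.prems IfTrue.hyps show ?case
    by (cases rule: big_step.cases) (use IfTrue.IH in blast)+
next
  case (IfFalse b s c2 t s' c1)
  from IfFalse.prems IfFalse.hyps show ?case
    by (cases rule: big_step.cases) (use IfFalse.IH in blast)+
next
  case (WhileFalse b s c)
  from WhileFalse.prems WhileFalse.hyps show ?case by (cases rule: big_step.cases) auto
next
  case (WhileTrue b s c t1 s1 t2 s2)
  from WhileTrue.prems WhileTrue.hyps show ?case
    by (cases rule: big_step.cases) (use WhileTrue.IH in blast)+
qed (erule big_step.cases; simp)+


section \<open>The procedure as a real RAM program\<close>

abbreviation nv :: "string \<Rightarrow> nexp" where "nv x \<equiv> NVar x (NatC 0)"
abbreviation rv :: "string \<Rightarrow> rexp" where "rv x \<equiv> RVar x (NatC 0)"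
abbreviation nlet :: "string \<Rightarrow> nexp \<Rightarrow> com" where "nlet x a \<equiv> NAssign x (NatC 0) a"
abbreviation rlet :: "string \<Rightarrow> rexp \<Rightarrow> com" where "rlet x e \<equiv> RAssign x (NatC 0) e"

text \<open>Entry \<open>(i, j)\<close> of a row-major matrix with \<open>w\<close> columns is at address \<open>i * w + j\<close>.\<close>

abbreviation addr :: "nexp \<Rightarrow> nexp \<Rightarrow> nexp \<Rightarrow> nexp" where
  "addr i w j \<equiv> NAdd (NMul i w) j"

definition For :: "string \<Rightarrow> nexp \<Rightarrow> com \<Rightarrow> com" where
  "For x b c = (nlet x (NatC 0) ;; While (NLess (nv x) b) (c ;; nlet x (NAdd (nv x) (NatC 1))))"

text \<open>In the absence of a rounding operation the target dimension is found by counting.\<close>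

definition compute_k :: "real \<Rightarrow> com" where
  "compute_k c =
     (rlet ''x'' (RDiv (RMul (RealC c) (RLn (OfNat (nv ''n'')))) (RMul (rv ''delta'') (rv ''delta''))) ;;
      nlet ''k'' (NatC 0) ;;
      While (RLess (OfNat (nv ''k'')) (rv ''x'')) (nlet ''k'' (NAdd (nv ''k'') (NatC 1))))"

definition draw_matrix :: com where
  "draw_matrix =
     For ''r'' (nv ''k'') (For ''t'' (nv ''d'') (Flip ''R'' (addr (nv ''r'') (nv ''d'') (nv ''t''))))"

definition project_points :: com where
  "project_points =
     For ''i'' (nv ''n'') (For ''r'' (nv ''k'')
       (rlet ''y'' (RealC 0) ;;
        For ''t'' (nv ''d'')
          (rlet ''y'' (RAdd (rv ''y'')
             (RMul (RVar ''R'' (addr (nv ''r'') (nv ''d'') (nv ''t'')))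
                   (RVar ''P'' (addr (nv ''i'') (nv ''d'') (nv ''t'')))))) ;;
        RAssign ''F'' (addr (nv ''i'') (nv ''k'') (nv ''r''))
          (RMul (RDiv (RealC 1) (RSqrt (OfNat (nv ''k'')))) (rv ''y''))))"

text \<open>Stores the squared distance between the projections of points \<open>q\<close> and \<open>m\<close> in \<open>w\<close>.\<close>

definition compute_W :: com where
  "compute_W =
     (rlet ''w'' (RealC 0) ;;
      For ''r'' (nv ''k'')
        (rlet ''z'' (RSub (RVar ''F'' (addr (nv ''q'') (nv ''k'') (nv ''r'')))
                          (RVar ''F'' (addr (nv ''m'') (nv ''k'') (nv ''r'')))) ;;
         rlet ''w'' (RAdd (rv ''w'') (RMul (rv ''z'') (rv ''z'')))))"

text \<open>Array \<open>T\<close> lists the chosen indices, \<open>inT\<close> is its characteristic function, and \<open>D\<close> holds for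
  each point its minimum distance to the chosen ones. \<open>q\<close> is the most recently chosen index.\<close>

definition first_center :: com where
  "first_center =
     (For ''m'' (nv ''n'') (NAssign ''inT'' (nv ''m'') (NatC 0)) ;;
      nlet ''q'' (NatC 0) ;;
      NAssign ''T'' (NatC 0) (nv ''q'') ;;
      NAssign ''inT'' (nv ''q'') (NatC 1) ;;
      nlet ''size'' (NatC 1) ;;
      For ''m'' (nv ''n'') (compute_W ;; RAssign ''D'' (nv ''m'') (rv ''w'')))"

definition select_farthest :: com where
  "select_farthest =
     (nlet ''found'' (NatC 0) ;;
      For ''m'' (nv ''n'')
        (If (NLess (NVar ''inT'' (nv ''m'')) (NatC 1))
           (If (NLess (nv ''found'') (NatC 1))
              (nlet ''q'' (nv ''m'') ;; nlet ''found'' (NatC 1))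
              (If (RLess (RVar ''D'' (nv ''q'')) (RVar ''D'' (nv ''m'')))
                 (nlet ''q'' (nv ''m''))
                 Skip))
           Skip))"

definition add_center :: com where
  "add_center =
     (NAssign ''T'' (nv ''size'') (nv ''q'') ;;
      NAssign ''inT'' (nv ''q'') (NatC 1) ;;
      nlet ''size'' (NAdd (nv ''size'') (NatC 1)) ;;
      For ''m'' (nv ''n'')
        (compute_W ;;
         If (RLess (rv ''w'') (RVar ''D'' (nv ''m'')))
           (RAssign ''D'' (nv ''m'') (rv ''w''))
           Skip))"

definition dimred_ham_center :: "real \<Rightarrow> com" where
  "dimred_ham_center c =
     (compute_k c ;; draw_matrix ;; project_points ;; first_center ;;
      While (NLess (nv ''size'') (nv ''l'')) (select_farthest ;; add_center))"

text \<open>The coin outcomes are the entries of the random matrix, row by row. All memory that does not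
  hold the input has arbitrary contents.\<close>

definition dimred_input ::
  "nat \<Rightarrow> nat \<Rightarrow> nat \<Rightarrow> (nat \<Rightarrow> real vec) \<Rightarrow> real \<Rightarrow> real mat \<Rightarrow> state \<Rightarrow> bool" where
  "dimred_input n d l p \<delta> R s \<longleftrightarrow>
     nmem s ''n'' 0 = n \<and> nmem s ''d'' 0 = d \<and> nmem s ''l'' 0 = l \<and>
     rmem s ''delta'' 0 = \<delta> \<and>
     (\<forall>i<n. \<forall>j<d. rmem s ''P'' (i * d + j) = vec_index (p i) j) \<and>
     coins s = [R $$ (i, j). i \<leftarrow> [0..<dim_row R], j \<leftarrow> [0..<dim_col R]]"

definition dimred_result :: "nat \<Rightarrow> state \<Rightarrow> nat set" where
  "dimred_result l s = nmem s ''T'' ` {..<l}"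

end

theory Submission
  imports Defs
begin

text \<open>
  For a difference \<open>v\<close> of two points, with \<open>h = \<parallel>v\<parallel>\<^sup>2\<close> equal to their Hamming distance, a row of the
  matrix yields a signed sum \<open>S = \<Sum>\<^sub>t \<plusminus> v\<^sub>t\<close>. Bounds on \<open>E exp (\<theta> S\<^sup>2)\<close> and \<open>E exp (- \<theta> S\<^sup>2)\<close> give
  Chernoff bounds for the sum over the \<open>k\<close> independent rows, and a union bound over all pairs shows
  that, with probability at least \<open>1 - n\<^sup>-\<^sup>\<beta>\<close>, every \<open>W i j\<close> is within a factor \<open>1 \<plusminus> \<epsilon> / 5\<close> of the
  Hamming distance.

  On this event the guarantees are deterministic. If a point were too far from the chosen centers
  \<open>T\<close>, then by the farthest-point rule that point and the centers would form \<open>l + 1\<close> points with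
  pairwise Hamming distances exceeding \<open>2 OPT\<close> (for centers) or \<open>OPT\<close> (for diameters), since
  \<open>(1 - \<epsilon> / 5) (2 + \<epsilon>) \<ge> 2 (1 + \<epsilon> / 5)\<close>; but two of them lie in the same optimal cluster.
\<close>

section \<open>Tail bounds for random sign matrices\<close>

abbreviation signs :: "'i set \<Rightarrow> ('i \<Rightarrow> real) pmf" where
  "signs A \<equiv> Pi_pmf A 0 (\<lambda>_. pmf_of_set {- 1, 1})"

lemma finite_set_signs: "finite A \<Longrightarrow> finite (set_pmf (signs A))"
  by (simp add: set_Pi_pmf finite_PiE_dflt)

lemma integrable_signs: "finite A \<Longrightarrow> integrable (measure_pmf (signs A)) (F :: _ \<Rightarrow> real)"
  by (intro integrable_measure_pmf_finite finite_set_signs)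

text \<open>Conditioning on the sign at \<open>x\<close> leaves an expectation over the remaining
  signs; the moment bounds below are proved by induction through this rule.\<close>

lemma expectation_signs_insert:
  fixes F :: "('i \<Rightarrow> real) \<Rightarrow> real"
  assumes "finite A" "x \<notin> A"
  shows "measure_pmf.expectation (signs (insert x A)) F =
    measure_pmf.expectation (signs A) (\<lambda>f. (F (f(x := 1)) + F (f(x := - 1))) / 2)"
proof -
  have "measure_pmf.expectation (signs (insert x A)) F =
    measure_pmf.expectation (pmf_of_set {- 1, 1} \<bind> (\<lambda>y. map_pmf (\<lambda>f. f(x := y)) (signs A))) F"
    using assms by (subst Pi_pmf_insert') (simp_all add: map_pmf_def)
  also have "\<dots> = (\<Sum>y\<in>{- 1, 1}. pmf (pmf_of_set {- 1, 1}) y *\<^sub>R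
      measure_pmf.expectation (map_pmf (\<lambda>f. f(x := y)) (signs A)) F)"
    by (rule pmf_expectation_bind) (use assms in \<open>auto simp: finite_set_signs\<close>)
  also have "\<dots> = (measure_pmf.expectation (signs A) (\<lambda>f. F (f(x := 1)))
      + measure_pmf.expectation (signs A) (\<lambda>f. F (f(x := - 1)))) / 2"
    by (simp add: pmf_of_set)
  also have "\<dots> = measure_pmf.expectation (signs A) (\<lambda>f. (F (f(x := 1)) + F (f(x := - 1))) / 2)"
    by (simp add: Bochner_Integration.integral_add integrable_signs assms)
  finally show ?thesis .
qed

lemma signed_sum_insert:
  fixes v :: "'i \<Rightarrow> real"
  assumes "finite A" "x \<notin> A"
  shows "(\<Sum>i\<in>insert x A. (f(x := y)) i * v i) = y * v x + (\<Sum>i\<in>A. f i * v i)"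
  using assms by (simp add: sum.insert) (intro sum.cong; auto)

text \<open>Compares the coefficients 1 / (2n)! of cosh x with 1 / (2^n n!) of exp (x^2 /
  2).\<close>

lemma two_power_fact_le: "2 ^ n * fact n \<le> (fact (2 * n) :: real)"
proof (induction n)
  case (Suc n)
  have "2 ^ Suc n * fact (Suc n) = (2 * (1 + real n)) * (2 ^ n * fact n)"
    by simp
  also have "\<dots> \<le> (2 * (1 + real n)) * fact (2 * n)"
    by (intro mult_left_mono Suc) auto
  also have "\<dots> \<le> (2 + 2 * real n) * ((1 + 2 * real n) * fact (2 * n))"
    by (auto intro!: mult_left_mono simp: mult_le_cancel_right1)
  also have "\<dots> = fact (2 * Suc n)"
    by (simp add: algebra_simps)
  finally show ?case .
qed simp

text \<open>The sub-Gaussian estimate for a single sign, obtained by comparing two power series term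
  by term.\<close>

lemma cosh_le_exp_square: "cosh x \<le> exp (x\<^sup>2 / 2)" for x :: real
proof (rule sums_le)
  have "strict_mono (\<lambda>n::nat. 2 * n)"
    by (simp add: strict_mono_def)
  \<comment> \<open>The odd terms of the cosh series vanish, so reindexing by the even numbers keeps
    the sum.\<close>
  then show "(\<lambda>n. x ^ (2 * n) /\<^sub>R fact (2 * n)) sums cosh x"
    using cosh_converges[of x]
    by (subst (asm) sums_mono_reindex[of "\<lambda>n. 2 * n", symmetric]) (auto elim!: evenE)
  show "(\<lambda>n. (x\<^sup>2 / 2) ^ n /\<^sub>R fact n) sums exp (x\<^sup>2 / 2)"
    by (rule exp_converges)
  show "x ^ (2 * n) /\<^sub>R fact (2 * n) \<le> (x\<^sup>2 / 2) ^ n /\<^sub>R fact n" for n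
    using two_power_fact_le[of n]
    by (auto simp: power_mult power_divide divide_simps mult.commute[of "fact n"] simp flip: power_mult intro!: mult_left_mono)
qed

text \<open>Averaging \<open>exp (\<theta> (s \<plusminus> v x)\<^sup>2)\<close> over the last sign replaces \<open>\<theta>\<close> by
  \<open>\<theta> (1 + u) \<le> \<theta> / (1 - u)\<close> with \<open>u = 2 \<theta> (v x)\<^sup>2\<close>, which is what makes the induction close.\<close>

lemma expectation_exp_square_le:
  fixes v :: "'i \<Rightarrow> real"
  assumes "finite A" "0 \<le> \<theta>" "2 * \<theta> * (\<Sum>i\<in>A. (v i)\<^sup>2) < 1"
  shows "measure_pmf.expectation (signs A) (\<lambda>f. exp (\<theta> * (\<Sum>i\<in>A. f i * v i)\<^sup>2))
     \<le> 1 / sqrt (1 - 2 * \<theta> * (\<Sum>i\<in>A. (v i)\<^sup>2))"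
  using assms
proof (induction A arbitrary: \<theta> rule: finite_induct)
  case empty
  then show ?case by simp
next
  case (insert x A)
  define h where "h = (\<Sum>i\<in>A. (v i)\<^sup>2)"
  define u where "u = 2 * \<theta> * (v x)\<^sup>2"
  define w where "w = 2 * \<theta> * h"
  have h0: "h \<ge> 0" by (simp add: h_def sum_nonneg)
  have u0: "u \<ge> 0" "w \<ge> 0" using insert.prems h0 by (simp_all add: u_def w_def)
  have sumh: "2 * \<theta> * (\<Sum>i\<in>insert x A. (v i)\<^sup>2) = u + w"
    using insert.hyps by (simp add: h_def u_def w_def algebra_simps)
  have uw: "u + w < 1" using insert.prems sumh by simp
  have l': "2 * (\<theta> * (1 + u)) * h = w * (1 + u)" by (simp add: w_def algebra_simps)
  \<comment> \<open>The sign at \<open>x\<close> contributes the factor \<open>exp (u / 2)\<close>,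
    and the induction hypothesis gives \<open>1 / sqrt (1 - w * (1 + u))\<close>. The square root of
    this inequality bounds their product by \<open>1 / sqrt (1 - (u + w))\<close>, which is the
    exponential moment of a squared Gaussian. Multiplying by \<open>1 - u\<close> reduces it to
    \<open>(1 - u) * exp u \<le> 1\<close>.\<close>
  have key: "(1 - u - w) * exp u \<le> 1 - w * (1 + u)"
  proof -
    have "(1 - u) * exp u \<le> exp (- u) * exp u"
      using exp_ge_add_one_self[of "- u"] by (intro mult_right_mono) auto
    then have *: "(1 - u) * exp u \<le> 1" by (simp add: exp_minus)
    have "(1 - u) * ((1 - u - w) * exp u) = (1 - u - w) * ((1 - u) * exp u)" by simp
    also have "\<dots> \<le> (1 - u - w) * 1"
      using uw by (intro mult_left_mono *) auto
    also have "\<dots> \<le> (1 - u) * (1 - w * (1 + u))"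
      using u0 by (simp add: algebra_simps)
    finally show ?thesis using uw u0 by (simp add: mult_le_cancel_left)
  qed
  have pos: "1 - w * (1 + u) > 0"
  proof -
    have "(1 - u - w) * exp u > 0" using uw by simp
    with key show ?thesis by linarith
  qed
  have step: "(exp (\<theta> * (v x + s)\<^sup>2) + exp (\<theta> * (- v x + s)\<^sup>2)) / 2
      \<le> exp (u / 2) * exp (\<theta> * (1 + u) * s\<^sup>2)" for s
  proof -
    \<comment> \<open>The mixed term 2 \<theta> s v has opposite signs in the two squares, so the
      average is a cosh; half of its squared argument is
      \<open>\<theta> * u * s\<^sup>2\<close>.\<close>
    have "(exp (\<theta> * (v x + s)\<^sup>2) + exp (\<theta> * (- v x + s)\<^sup>2)) / 2
      = exp (\<theta> * s\<^sup>2 + \<theta> * (v x)\<^sup>2) * cosh (2 * \<theta> * s * v x)"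
      by (simp add: cosh_def power2_eq_square algebra_simps flip: exp_add)
    also have "\<dots> \<le> exp (\<theta> * s\<^sup>2 + \<theta> * (v x)\<^sup>2) * exp ((2 * \<theta> * s * v x)\<^sup>2 / 2)"
      by (intro mult_left_mono cosh_le_exp_square) auto
    also have "\<dots> = exp (u / 2) * exp (\<theta> * (1 + u) * s\<^sup>2)"
      by (simp add: u_def power2_eq_square algebra_simps flip: exp_add)
    finally show ?thesis .
  qed
  have sqrt_exp: "sqrt (exp u) = exp (u / 2)"
    by (rule real_sqrt_unique) (simp_all add: power2_eq_square flip: exp_add)
  have "measure_pmf.expectation (signs (insert x A)) (\<lambda>f. exp (\<theta> * (\<Sum>i\<in>insert x A. f i * v i)\<^sup>2))
    = measure_pmf.expectation (signs A) (\<lambda>f. (exp (\<theta> * (v x + (\<Sum>i\<in>A. f i * v i))\<^sup>2)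
        + exp (\<theta> * (- v x + (\<Sum>i\<in>A. f i * v i))\<^sup>2)) / 2)"
    by (subst expectation_signs_insert[OF insert.hyps(1,2)], subst (1 2) signed_sum_insert)
      (use insert.hyps in auto)
  also have "\<dots> \<le> measure_pmf.expectation (signs A)
      (\<lambda>f. exp (u / 2) * exp (\<theta> * (1 + u) * (\<Sum>i\<in>A. f i * v i)\<^sup>2))"
    by (intro integral_mono integrable_signs insert.hyps step)
  also have "\<dots> = exp (u / 2) * measure_pmf.expectation (signs A)
      (\<lambda>f. exp (\<theta> * (1 + u) * (\<Sum>i\<in>A. f i * v i)\<^sup>2))"
    by simp
  also have "\<dots> \<le> exp (u / 2) * (1 / sqrt (1 - w * (1 + u)))"
  proof (intro mult_left_mono)
    have "measure_pmf.expectation (signs A) (\<lambda>f. exp (\<theta> * (1 + u) * (\<Sum>i\<in>A. f i * v i)\<^sup>2))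
      \<le> 1 / sqrt (1 - 2 * (\<theta> * (1 + u)) * (\<Sum>i\<in>A. (v i)\<^sup>2))"
    proof (rule insert.IH)
      show "2 * (\<theta> * (1 + u)) * (\<Sum>i\<in>A. (v i)\<^sup>2) < 1"
        using pos l' unfolding h_def by linarith
    qed (use insert.prems u0 in auto)
    then show "measure_pmf.expectation (signs A) (\<lambda>f. exp (\<theta> * (1 + u) * (\<Sum>i\<in>A. f i * v i)\<^sup>2))
      \<le> 1 / sqrt (1 - w * (1 + u))"
      using l' unfolding h_def by simp
  qed simp
  also have "\<dots> \<le> 1 / sqrt (1 - (u + w))"
  proof -
    have "sqrt ((1 - u - w) * exp u) \<le> sqrt (1 - w * (1 + u))"
      using key by (rule real_sqrt_le_mono)
    then have "sqrt (1 - (u + w)) * exp (u / 2) \<le> sqrt (1 - w * (1 + u))"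
      by (simp add: real_sqrt_mult diff_diff_eq sqrt_exp)
    then show ?thesis using pos uw
      by (simp add: divide_simps mult.commute)
  qed
  finally show ?case using sumh by simp
qed

text \<open>The mixed terms cancel when the sign at \<open>x\<close> is averaged.\<close>

lemma expectation_signed_sum_square:
  fixes v :: "'i \<Rightarrow> real"
  assumes "finite A"
  shows "measure_pmf.expectation (signs A) (\<lambda>f. (\<Sum>i\<in>A. f i * v i)\<^sup>2) = (\<Sum>i\<in>A. (v i)\<^sup>2)"
  using assms
proof (induction A rule: finite_induct)
  case (insert x A)
  have "measure_pmf.expectation (signs (insert x A)) (\<lambda>f. (\<Sum>i\<in>insert x A. f i * v i)\<^sup>2)
    = measure_pmf.expectation (signs A) (\<lambda>f. (\<Sum>i\<in>A. f i * v i)\<^sup>2 + (v x)\<^sup>2)"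
    by (subst expectation_signs_insert[OF insert.hyps(1,2)], subst (1 2) signed_sum_insert)
      (use insert.hyps in \<open>auto simp: power2_eq_square algebra_simps add_divide_distrib\<close>)
  then show ?case
    using insert by (simp add: integrable_signs)
qed simp

lemma expectation_signed_sum_fourth_le:
  fixes v :: "'i \<Rightarrow> real"
  assumes "finite A"
  shows "measure_pmf.expectation (signs A) (\<lambda>f. (\<Sum>i\<in>A. f i * v i) ^ 4) \<le> 3 * (\<Sum>i\<in>A. (v i)\<^sup>2)\<^sup>2"
  using assms
proof (induction A rule: finite_induct)
  case (insert x A)
  define h where "h = (\<Sum>i\<in>A. (v i)\<^sup>2)"
  have "measure_pmf.expectation (signs (insert x A)) (\<lambda>f. (\<Sum>i\<in>insert x A. f i * v i) ^ 4)
    = measure_pmf.expectation (signs A)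
        (\<lambda>f. (\<Sum>i\<in>A. f i * v i) ^ 4 + 6 * (v x)\<^sup>2 * (\<Sum>i\<in>A. f i * v i)\<^sup>2 + (v x) ^ 4)"
    by (subst expectation_signs_insert[OF insert.hyps(1,2)], subst (1 2) signed_sum_insert)
      (use insert.hyps in \<open>auto simp: power2_eq_square power4_eq_xxxx algebra_simps add_divide_distrib\<close>)
  also have "\<dots> = measure_pmf.expectation (signs A) (\<lambda>f. (\<Sum>i\<in>A. f i * v i) ^ 4)
      + 6 * (v x)\<^sup>2 * h + (v x) ^ 4"
    using insert.hyps by (simp add: integrable_signs expectation_signed_sum_square h_def)
  \<comment> \<open>Enlarging the last coefficient from 1 to 3 completes the square 3 (h +
    v^2)^2.\<close>
  also have "\<dots> \<le> 3 * h\<^sup>2 + 6 * (v x)\<^sup>2 * h + 3 * (v x) ^ 4"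
    using insert.IH by (simp add: h_def add.commute add_increasing)
  also have "\<dots> = 3 * (\<Sum>i\<in>insert x A. (v i)\<^sup>2)\<^sup>2"
    using insert.hyps by (simp add: h_def power2_eq_square power4_eq_xxxx algebra_simps)
  finally show ?case .
qed simp

text \<open>Multiplying by exp u, which is at least 1 + u + u^2 / 2, suffices, because the product
  of the two quadratics is 1 + u^4 / 4.\<close>

lemma exp_minus_le_quadratic:
  fixes u :: real
  assumes "0 \<le> u"
  shows "exp (- u) \<le> 1 - u + u\<^sup>2 / 2"
proof -
  have "1 \<le> (1 - u + u\<^sup>2 / 2) * (1 + u + u\<^sup>2 / 2)"
    using assms by (simp add: power2_eq_square algebra_simps)
  moreover have "(1 - u + u\<^sup>2 / 2) \<ge> 0"
    using sum_power2_ge_zero[of "u - 1" 1] by (simp add: power2_eq_square algebra_simps)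
  then have "(1 - u + u\<^sup>2 / 2) * (1 + u + u\<^sup>2 / 2) \<le> (1 - u + u\<^sup>2 / 2) * exp u"
    by (intro mult_left_mono exp_lower_Taylor_quadratic assms)
  ultimately show ?thesis by (simp add: exp_minus divide_simps)
qed

text \<open>For a negative exponent a second-order bound on exp is enough: the second moment is
  exactly \<open>h\<close>, and the fourth moment controls the quadratic term.\<close>

lemma expectation_exp_minus_square_le:
  fixes v :: "'i \<Rightarrow> real"
  assumes "finite A" "0 \<le> \<theta>"
  defines "h \<equiv> (\<Sum>i\<in>A. (v i)\<^sup>2)"
  shows "measure_pmf.expectation (signs A) (\<lambda>f. exp (- (\<theta> * (\<Sum>i\<in>A. f i * v i)\<^sup>2)))
     \<le> exp (3 / 2 * (\<theta> * h)\<^sup>2 - \<theta> * h)"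
proof -
  have "measure_pmf.expectation (signs A) (\<lambda>f. exp (- (\<theta> * (\<Sum>i\<in>A. f i * v i)\<^sup>2)))
    \<le> measure_pmf.expectation (signs A) (\<lambda>f. 1 - \<theta> * (\<Sum>i\<in>A. f i * v i)\<^sup>2
        + \<theta>\<^sup>2 / 2 * (\<Sum>i\<in>A. f i * v i) ^ 4)"
  proof (intro integral_mono integrable_signs assms)
    fix f
    show "exp (- (\<theta> * (\<Sum>i\<in>A. f i * v i)\<^sup>2)) \<le> 1 - \<theta> * (\<Sum>i\<in>A. f i * v i)\<^sup>2
        + \<theta>\<^sup>2 / 2 * (\<Sum>i\<in>A. f i * v i) ^ 4"
      using exp_minus_le_quadratic[of "\<theta> * (\<Sum>i\<in>A. f i * v i)\<^sup>2"] assms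
      by (simp add: power_mult_distrib flip: power_mult)
  qed
  also have "\<dots> = 1 - \<theta> * h + \<theta>\<^sup>2 / 2 * measure_pmf.expectation (signs A) (\<lambda>f. (\<Sum>i\<in>A. f i * v i) ^ 4)"
    by (simp add: integrable_signs assms expectation_signed_sum_square)
  also have "\<dots> \<le> 1 - \<theta> * h + \<theta>\<^sup>2 / 2 * (3 * h\<^sup>2)"
    unfolding h_def
    by (intro add_mono order.refl mult_left_mono expectation_signed_sum_fourth_le assms) auto
  also have "\<dots> = 1 + (3 / 2 * (\<theta> * h)\<^sup>2 - \<theta> * h)"
    by (simp add: power_mult_distrib)
  also have "\<dots> \<le> exp (3 / 2 * (\<theta> * h)\<^sup>2 - \<theta> * h)"
    by (rule exp_ge_add_one_self)
  finally show ?thesis .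
qed

section \<open>Independent rows and Chernoff bounds\<close>

text \<open>Turns a matrix of independent signs into independent rows. The point masses are compared
  directly: both factor over the entries, and both vanish if \<open>g\<close> has a nonzero entry
  outside \<open>A \<times> B\<close>.\<close>

lemma signs_curry:
  assumes "finite A" "finite B"
  shows "map_pmf curry (signs (A \<times> B)) = Pi_pmf A (\<lambda>_. 0) (\<lambda>_. signs B)"
proof (rule pmf_eqI)
  fix g :: "'a \<Rightarrow> 'b \<Rightarrow> real"
  have "pmf (map_pmf curry (signs (A \<times> B))) g = pmf (map_pmf curry (signs (A \<times> B))) (curry (\<lambda>(a, b). g a b))"
    by simp
  also have "\<dots> = pmf (signs (A \<times> B)) (\<lambda>(a, b). g a b)"
    by (rule pmf_map_inj') (auto simp: inj_def curry_def fun_eq_iff)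
  also have "\<dots> = pmf (Pi_pmf A (\<lambda>_. 0) (\<lambda>_. signs B)) g"
  proof (cases "\<forall>a b. (a \<notin> A \<or> b \<notin> B) \<longrightarrow> g a b = 0")
    case True
    then have "pmf (signs (A \<times> B)) (\<lambda>(a, b). g a b) = (\<Prod>(a, b)\<in>A \<times> B. pmf (pmf_of_set {- 1, 1}) (g a b))"
      using assms by (subst pmf_Pi) (auto intro!: prod.cong)
    also have "\<dots> = (\<Prod>a\<in>A. pmf (signs B) (g a))"
      using assms True by (subst prod.cartesian_product[symmetric], intro prod.cong) (auto simp: pmf_Pi)
    also have "\<dots> = pmf (Pi_pmf A (\<lambda>_. 0) (\<lambda>_. signs B)) g"
      using assms True by (subst (2) pmf_Pi) (auto simp: fun_eq_iff)
    finally show ?thesis .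
  next
    case False
    then obtain a b where ab: "a \<notin> A \<or> b \<notin> B" "g a b \<noteq> 0" by blast
    have "pmf (signs (A \<times> B)) (\<lambda>(a, b). g a b) = 0"
      using assms ab by (subst pmf_Pi) auto
    moreover have "pmf (Pi_pmf A (\<lambda>_. 0) (\<lambda>_. signs B)) g = 0"
    proof (cases "a \<in> A")
      case True
      then have "pmf (signs B) (g a) = 0" using assms ab by (subst pmf_Pi) auto
      then show ?thesis using assms True by (subst pmf_Pi) auto
    next
      case False
      then have "g a \<noteq> (\<lambda>_. 0)" using ab by (auto simp: fun_eq_iff)
      then show ?thesis using assms False by (subst pmf_Pi) auto
    qed
    ultimately show ?thesis by simp
  qed
  finally show "pmf (map_pmf curry (signs (A \<times> B))) g = pmf (Pi_pmf A (\<lambda>_. 0) (\<lambda>_. signs B)) g" .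
qed

text \<open>The rows are independent and identically distributed, so the exponential moment of a sum
  over rows is a power.\<close>

lemma expectation_prod_rows:
  fixes g :: "('b \<Rightarrow> real) \<Rightarrow> real"
  assumes "finite A" "finite B" "\<And>y. g y \<ge> 0"
  shows "measure_pmf.expectation (signs (A \<times> B)) (\<lambda>f. \<Prod>a\<in>A. g (\<lambda>b. f (a, b)))
    = measure_pmf.expectation (signs B) g ^ card A"
proof -
  have "measure_pmf.expectation (signs (A \<times> B)) (\<lambda>f. \<Prod>a\<in>A. g (\<lambda>b. f (a, b)))
    = measure_pmf.expectation (map_pmf curry (signs (A \<times> B))) (\<lambda>f. \<Prod>a\<in>A. g (f a))"
    by (simp add: curry_def)
  also have "\<dots> = (\<Prod>a\<in>A. measure_pmf.expectation (signs B) g)"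
    unfolding signs_curry[OF assms(1,2)]
    by (rule expectation_prod_Pi_pmf) (use assms in \<open>auto intro: integrable_signs\<close>)
  finally show ?thesis by simp
qed

text \<open>Markov's inequality in exponential form: the indicator of \<open>0 \<le> F f\<close> is
  at most \<open>exp (F f)\<close>.\<close>

lemma prob_signs_exp_le:
  assumes "finite A"
  shows "measure_pmf.prob (signs A) {f. 0 \<le> (F f :: real)} \<le> measure_pmf.expectation (signs A) (\<lambda>f. exp (F f))"
proof -
  have "measure_pmf.prob (signs A) {f. 0 \<le> F f} = measure_pmf.expectation (signs A) (indicator {f. 0 \<le> F f})"
    by simp
  also have "\<dots> \<le> measure_pmf.expectation (signs A) (\<lambda>f. exp (F f))"
    by (intro integral_mono integrable_signs assms) (auto simp: indicator_def)
  finally show ?thesis .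
qed

lemma prob_rows_upper_tail:
  fixes v :: "'b \<Rightarrow> real"
  assumes fin: "finite A" "finite B" and \<delta>: "0 < \<delta>" "\<delta> \<le> 1"
  defines "h \<equiv> (\<Sum>b\<in>B. (v b)\<^sup>2)"
  assumes h: "0 < h"
  shows "measure_pmf.prob (signs (A \<times> B))
      {f. (1 + \<delta>) * (real (card A) * h) \<le> (\<Sum>a\<in>A. (\<Sum>b\<in>B. f (a, b) * v b)\<^sup>2)}
    \<le> exp (- (real (card A) * \<delta>\<^sup>2 / 16))"
proof -
  define k where "k = card A"
  \<comment> \<open>With \<open>\<theta> * h = \<delta> / 8\<close> each row contributes the
    exponent \<delta>/8 + \<delta>^2/16 - (1 + \<delta>) \<delta>/8 = - \<delta>^2/16.\<close>
  define \<theta> where "\<theta> = \<delta> / (8 * h)"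
  have lh: "\<theta> * h = \<delta> / 8" "\<theta> > 0" using h \<delta> by (simp_all add: \<theta>_def)
  let ?S = "\<lambda>f a. (\<Sum>b\<in>B. f (a, b) * v b)\<^sup>2"
  have "measure_pmf.prob (signs (A \<times> B)) {f. (1 + \<delta>) * (k * h) \<le> (\<Sum>a\<in>A. ?S f a)}
    = measure_pmf.prob (signs (A \<times> B)) {f. 0 \<le> \<theta> * (\<Sum>a\<in>A. ?S f a) - \<theta> * ((1 + \<delta>) * (k * h))}"
    using lh by (intro arg_cong2[where f = measure]) auto
  also have "\<dots> \<le> measure_pmf.expectation (signs (A \<times> B))
      (\<lambda>f. exp (\<theta> * (\<Sum>a\<in>A. ?S f a) - \<theta> * ((1 + \<delta>) * (k * h))))"
    by (rule prob_signs_exp_le) (use fin in auto)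
  also have "\<dots> = measure_pmf.expectation (signs (A \<times> B))
      (\<lambda>f. (\<Prod>a\<in>A. exp (\<theta> * ?S f a)) * exp (- ((1 + \<delta>) * (k * (\<theta> * h)))))"
    using fin by (simp add: sum_distrib_left exp_diff exp_minus divide_inverse mult_ac flip: exp_sum)
  also have "\<dots> = measure_pmf.expectation (signs B) (\<lambda>f. exp (\<theta> * (\<Sum>b\<in>B. f b * v b)\<^sup>2)) ^ k
      * exp (- ((1 + \<delta>) * (k * (\<theta> * h))))"
    using expectation_prod_rows[OF fin, of "\<lambda>y. exp (\<theta> * (\<Sum>b\<in>B. y b * v b)\<^sup>2)"]
    by (simp add: k_def)
  also have "\<dots> \<le> exp (\<delta> / 8 + \<delta>\<^sup>2 / 16) ^ k * exp (- ((1 + \<delta>) * (k * (\<theta> * h))))"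
  proof (intro mult_right_mono power_mono)
    have "measure_pmf.expectation (signs B) (\<lambda>f. exp (\<theta> * (\<Sum>b\<in>B. f b * v b)\<^sup>2))
      \<le> 1 / sqrt (1 - 2 * \<theta> * h)"
      unfolding h_def by (rule expectation_exp_square_le) (use fin lh \<delta> h_def in auto)
    also have "1 - 2 * \<theta> * h = 1 - \<delta> / 4"
      using lh(1) by linarith
    also have "1 / sqrt (1 - \<delta> / 4) = exp (- ln (sqrt (1 - \<delta> / 4)))"
      using \<delta> by (subst exp_minus, subst exp_ln) (auto simp: inverse_eq_divide)
    also have "\<dots> = exp (- (ln (1 - \<delta> / 4) / 2))"
      using \<delta> by (simp add: ln_sqrt)
    also have "\<dots> \<le> exp (\<delta> / 8 + \<delta>\<^sup>2 / 16)"
      using ln_one_minus_pos_lower_bound[of "\<delta> / 4"] \<delta> by (simp add: power2_eq_square)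
    finally show "measure_pmf.expectation (signs B) (\<lambda>f. exp (\<theta> * (\<Sum>b\<in>B. f b * v b)\<^sup>2))
      \<le> exp (\<delta> / 8 + \<delta>\<^sup>2 / 16)" .
  qed (auto intro!: integral_nonneg_AE)
  also have "\<dots> = exp (- (k * \<delta>\<^sup>2 / 16))"
    by (simp add: lh(1) power2_eq_square algebra_simps add_divide_distrib flip: exp_add exp_of_nat_mult)
  finally show ?thesis by (simp add: k_def)
qed

lemma prob_rows_lower_tail:
  fixes v :: "'b \<Rightarrow> real"
  assumes fin: "finite A" "finite B" and \<delta>: "0 < \<delta>"
  defines "h \<equiv> (\<Sum>b\<in>B. (v b)\<^sup>2)"
  assumes h: "0 < h"
  shows "measure_pmf.prob (signs (A \<times> B))
      {f. (\<Sum>a\<in>A. (\<Sum>b\<in>B. f (a, b) * v b)\<^sup>2) \<le> (1 - \<delta>) * (real (card A) * h)}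
    \<le> exp (- (real (card A) * \<delta>\<^sup>2 / 16))"
proof -
  define k where "k = card A"
  \<comment> \<open>The exponent per row is 3/2 x^2 - \<delta> x with x =
    \<open>\<theta> * h\<close>; it is minimal at x = \<delta>/3, with value - \<delta>^2/6.\<close>
  define \<theta> where "\<theta> = \<delta> / (3 * h)"
  have lh: "\<theta> * h = \<delta> / 3" "\<theta> > 0" using h \<delta> by (simp_all add: \<theta>_def)
  let ?S = "\<lambda>f a. (\<Sum>b\<in>B. f (a, b) * v b)\<^sup>2"
  have "measure_pmf.prob (signs (A \<times> B)) {f. (\<Sum>a\<in>A. ?S f a) \<le> (1 - \<delta>) * (k * h)}
    = measure_pmf.prob (signs (A \<times> B)) {f. 0 \<le> \<theta> * ((1 - \<delta>) * (k * h)) - \<theta> * (\<Sum>a\<in>A. ?S f a)}"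
    using lh by (intro arg_cong2[where f = measure]) auto
  also have "\<dots> \<le> measure_pmf.expectation (signs (A \<times> B))
      (\<lambda>f. exp (\<theta> * ((1 - \<delta>) * (k * h)) - \<theta> * (\<Sum>a\<in>A. ?S f a)))"
    by (rule prob_signs_exp_le) (use fin in auto)
  also have "\<dots> = measure_pmf.expectation (signs (A \<times> B))
      (\<lambda>f. (\<Prod>a\<in>A. exp (- (\<theta> * ?S f a))) * exp ((1 - \<delta>) * (k * (\<theta> * h))))"
  proof -
    have "(\<Prod>a\<in>A. exp (- (\<theta> * ?S f a))) = exp (- (\<theta> * (\<Sum>a\<in>A. ?S f a)))" for f
      using fin by (simp add: sum_distrib_left sum_negf flip: exp_sum)
    then show ?thesis by (simp add: algebra_simps flip: exp_add)
  qed
  also have "\<dots> = measure_pmf.expectation (signs B) (\<lambda>f. exp (- (\<theta> * (\<Sum>b\<in>B. f b * v b)\<^sup>2))) ^ k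
      * exp ((1 - \<delta>) * (k * (\<theta> * h)))"
    using expectation_prod_rows[OF fin, of "\<lambda>y. exp (- (\<theta> * (\<Sum>b\<in>B. y b * v b)\<^sup>2))"]
    by (simp add: k_def)
  also have "\<dots> \<le> exp (3 / 2 * (\<theta> * h)\<^sup>2 - \<theta> * h) ^ k * exp ((1 - \<delta>) * (k * (\<theta> * h)))"
    unfolding h_def using lh fin
    by (intro mult_right_mono power_mono expectation_exp_minus_square_le) (auto intro!: integral_nonneg_AE)
  also have "\<dots> = exp (- (k * \<delta>\<^sup>2 / 6))"
    unfolding lh by (simp add: power2_eq_square field_simps flip: exp_add exp_of_nat_mult)
  \<comment> \<open>Weakened so that both tails share one bound.\<close>
  also have "\<dots> \<le> exp (- (k * \<delta>\<^sup>2 / 16))" by simp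
  finally show ?thesis by (simp add: k_def)
qed

section \<open>Farthest-point clustering under low distortion\<close>

lemma ham_commute: "dim_vec a = dim_vec b \<Longrightarrow> ham a b = ham b a"
  unfolding ham_def by (intro arg_cong[where f = card]) auto

lemma ham_self [simp]: "ham a a = 0"
  by (simp add: ham_def)

text \<open>Wherever \<open>a\<close> and \<open>c\<close> differ, \<open>b\<close> differs from at
  least one of them.\<close>

lemma ham_triangle:
  assumes "dim_vec a = dim_vec b"
  shows "ham a c \<le> ham a b + ham b c"
proof -
  have "ham a c \<le> card ({i. i < dim_vec a \<and> a $ i \<noteq> b $ i} \<union> {i. i < dim_vec b \<and> b $ i \<noteq> c $ i})"
    unfolding ham_def using assms by (intro card_mono) auto
  also have "\<dots> \<le> ham a b + ham b c"
    unfolding ham_def by (rule card_Un_le)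
  finally show ?thesis .
qed

lemma ham_pos: "dim_vec a = dim_vec b \<Longrightarrow> a \<noteq> b \<Longrightarrow> 0 < ham a b"
  unfolding ham_def by (subst card_gt_0_iff) auto

lemma greedy_set_props:
  assumes "greedy_set w n T" "0 < n"
  shows "T \<subseteq> {..<n} \<and> T \<noteq> {}"
  using assms by induction auto

text \<open>Each center was added as a farthest point, hence was at least as far from the earlier ones as
  \<open>v\<close> was at that time.\<close>

lemma greedy_set_separated:
  assumes "greedy_set w n T" "0 < n" and sym: "\<And>i j. i < n \<Longrightarrow> j < n \<Longrightarrow> w i j = w j i"
    and "x \<in> T" "y \<in> T" "x \<noteq> y" "v < n" "v \<notin> T" "\<forall>q\<in>T. s < w q v"
  shows "s < w x y"
  using assms(1,4-)
proof (induction arbitrary: v x y rule: greedy_set.induct)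
  case (add T m)
  have sub: "T \<subseteq> {..<n}" "T \<noteq> {}"
    using greedy_set_props[OF add.hyps(1) \<open>0 < n\<close>] by auto
  then have T: "finite T" "T \<noteq> {}"
    using finite_subset[OF _ finite_lessThan] by blast+
  \<comment> \<open>\<open>v\<close> was still a candidate when \<open>m\<close> was added, so the
    maximality of \<open>m\<close> applies to it.\<close>
  have "Min ((\<lambda>q. w q v) ` T) \<le> Min ((\<lambda>q. w q m) ` T)"
    using add.hyps(3) add.prems by auto
  moreover have "s < Min ((\<lambda>q. w q v) ` T)"
    using T add.prems by auto
  ultimately have "s < Min ((\<lambda>q. w q m) ` T)"
    by linarith
  then have new: "\<forall>q\<in>T. s < w q m"
    using T by simp
  consider "x = m" "y \<in> T" | "y = m" "x \<in> T" | "x \<in> T" "y \<in> T"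
    using add.prems by auto
  then show ?case
  proof cases
    case 1
    then show ?thesis using new sym[of m y] sub add.hyps(2) by auto
  next
    case 2
    then show ?thesis using new by auto
  next
    case 3
    then show ?thesis using add.IH[of x y v] add.prems by auto
  qed
qed simp

lemma W_commute:
  assumes "dim_vec (p i) = dim_vec (p j)"
  shows "W R p i j = W R p j i"
  unfolding W_def Let_def proj_def scalar_prod_def
  by (rule sum.cong) (auto simp: algebra_simps)

text \<open>This is where the accuracy \<epsilon>/5 comes from: (1 - \<epsilon>/5) (1 +
  \<epsilon>/2) exceeds 1 + \<epsilon>/5 by (\<epsilon> - \<epsilon>^2) / 10.\<close>

lemma distortion_ratio:
  fixes \<epsilon> s a :: real
  assumes "0 < \<epsilon>" "\<epsilon> < 1 / 2" "0 \<le> s" "(1 + \<epsilon> / 2) * s < a"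
  shows "(1 + \<epsilon> / 5) * s < (1 - \<epsilon> / 5) * a"
proof -
  have "(1 + \<epsilon> / 5) \<le> (1 - \<epsilon> / 5) * (1 + \<epsilon> / 2)"
    using assms by (simp add: field_simps)
  then have "(1 + \<epsilon> / 5) * s \<le> (1 - \<epsilon> / 5) * (1 + \<epsilon> / 2) * s"
    using assms by (intro mult_right_mono) auto
  also have "\<dots> = (1 - \<epsilon> / 5) * ((1 + \<epsilon> / 2) * s)" by simp
  also have "\<dots> < (1 - \<epsilon> / 5) * a"
    using assms by (intro mult_strict_left_mono) auto
  finally show ?thesis .
qed

text \<open>The Johnson-Lindenstrauss property for squared distances, since squared Euclidean and
  Hamming distance agree on 0/1 points. It is stated for arbitrary weights \<open>w\<close>, so that
  the pigeonhole argument does not mention a matrix.\<close>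

definition low_distortion :: "real \<Rightarrow> nat \<Rightarrow> (nat \<Rightarrow> real vec) \<Rightarrow> (nat \<Rightarrow> nat \<Rightarrow> real) \<Rightarrow> bool" where
  "low_distortion \<delta> n p w \<longleftrightarrow> (\<forall>i<n. \<forall>j<n.
     (1 - \<delta>) * real (ham (p i) (p j)) \<le> w i j \<and> w i j \<le> (1 + \<delta>) * real (ham (p i) (p j)))"

text \<open>Together with \<open>T\<close>, a point far from \<open>T\<close> makes \<open>l + 1\<close> points that are pairwise far apart, two
  of which must share a class of any classification into \<open>l\<close> classes.\<close>

lemma greedy_set_pigeonhole:
  assumes greedy: "greedy_set w n T" and sym: "\<And>i j. i < n \<Longrightarrow> j < n \<Longrightarrow> w i j = w j i"
    and dist: "low_distortion \<delta> n p w" "0 < \<delta>"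
    and v: "v < n" "\<forall>q\<in>T. (1 + \<delta>) * s < w q v" "0 \<le> s"
    and cls: "\<forall>i<n. cls i \<in> K" "finite K" "card K \<le> card T"
  shows "\<exists>x<n. \<exists>y<n. x \<noteq> y \<and> cls x = cls y \<and> s < real (ham (p x) (p y))"
proof -
  have T: "T \<subseteq> {..<n}" using greedy_set_props[OF greedy] v by auto
  then have fin: "finite T" using finite_subset by blast
  \<comment> \<open>A point has Hamming distance 0 to itself, so low distortion forces
    \<open>w v v \<le> 0\<close>.\<close>
  have "v \<notin> T"
  proof
    assume "v \<in> T"
    then have "(1 + \<delta>) * s < w v v" using v by blast
    also have "w v v \<le> 0" using dist(1) v(1) unfolding low_distortion_def by fastforce
    finally show False using v(3) dist(2) by (simp add: mult_less_0_iff)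
  qed
  have "\<not> inj_on cls (insert v T)"
  proof
    assume "inj_on cls (insert v T)"
    then have "card (insert v T) \<le> card K"
      using T v cls by (intro card_inj_on_le[of cls]) auto
    then show False using \<open>v \<notin> T\<close> fin cls by simp
  qed
  then obtain x y where xy: "x \<in> insert v T" "y \<in> insert v T" "x \<noteq> y" "cls x = cls y"
    unfolding inj_on_def by blast
  \<comment> \<open>Pairs containing \<open>v\<close> are far by assumption; for two members of
    \<open>T\<close> the farthest-point rule gives it.\<close>
  have "(1 + \<delta>) * s < w x y"
  proof (cases "x = v \<or> y = v")
    case True
    then show ?thesis using xy v sym[of v y] T by auto
  next
    case False
    then show ?thesis
      using greedy_set_separated[OF greedy _ sym, of x y v] xy v \<open>v \<notin> T\<close> by auto
  qed
  moreover have "x < n" "y < n" using xy T v by auto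
  then have "w x y \<le> (1 + \<delta>) * real (ham (p x) (p y))"
    using dist(1) by (auto simp: low_distortion_def)
  ultimately have "s < real (ham (p x) (p y))"
    using dist(2) by (smt (verit) mult_le_cancel_left_pos)
  then show ?thesis using xy \<open>x < n\<close> \<open>y < n\<close> by blast
qed

section \<open>Attained optima and diameters\<close>

text \<open>Any \<open>l\<close> points of \<open>P\<close> show that the infimum is over a nonempty
  set of naturals, hence a minimum.\<close>

lemma opt_center_attained:
  assumes "finite P" "P \<subseteq> carrier_vec d" "l \<le> card P"
  obtains C where "C \<subseteq> carrier_vec d" "card C = l" "center_cost P C = opt_center d l P"
proof -
  obtain C where "C \<subseteq> P" "card C = l" using assms(3) obtain_subset_with_card_n by metis
  then have "C \<in> {C. C \<subseteq> carrier_vec d \<and> card C = l}" using assms(2) by simp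
  then have "opt_center d l P \<in> center_cost P ` {C. C \<subseteq> carrier_vec d \<and> card C = l}"
    unfolding opt_center_def by (intro Inf_nat_def1) blast
  then obtain C where "C \<subseteq> carrier_vec d" "card C = l" "opt_center d l P = center_cost P C"
    by blast
  then show ?thesis by (intro that[of C]) simp_all
qed

text \<open>The given partition only witnesses that the infimum is over a nonempty set; later the
  clusters of the procedure itself play this role.\<close>

lemma opt_diam_attained:
  assumes "partition_on P Q" "card Q = l"
  obtains Q' where "partition_on P Q'" "card Q' = l" "max_diameter Q' = opt_diam l P"
proof -
  have "opt_diam l P \<in> max_diameter ` {Q. partition_on P Q \<and> card Q = l}"
    unfolding opt_diam_def by (intro Inf_nat_def1) (use assms in auto)
  then show ?thesis using that by auto
qed

lemma ham_le_max_diameter: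
  assumes "finite Q" "C \<in> Q" "finite C" "u \<in> C" "v \<in> C"
  shows "ham u v \<le> max_diameter Q"
proof -
  have "ham u v \<le> cluster_diameter C"
    unfolding cluster_diameter_def using assms by (intro Max_ge) auto
  also have "\<dots> \<le> max_diameter Q"
    unfolding max_diameter_def using assms by (intro Max_ge) auto
  finally show ?thesis .
qed

lemma max_diameter_attained:
  assumes "finite Q" "Q \<noteq> {}" "\<forall>C\<in>Q. finite C \<and> C \<noteq> {}"
  obtains C u v where "C \<in> Q" "u \<in> C" "v \<in> C" "max_diameter Q = ham u v"
proof -
  have "max_diameter Q \<in> cluster_diameter ` Q"
    unfolding max_diameter_def using assms by (intro Max_in) auto
  then obtain C where C: "C \<in> Q" "max_diameter Q = cluster_diameter C" by auto
  then have "cluster_diameter C \<in> (\<lambda>(u, v). ham u v) ` (C \<times> C)"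
    unfolding cluster_diameter_def using assms by (intro Max_in) auto
  then show ?thesis using C that by auto
qed

section \<open>Approximation guarantees under low distortion\<close>

context
  fixes n d l :: nat and p :: "nat \<Rightarrow> real vec" and \<epsilon> :: real and R :: "real mat" and T :: "nat set"
  assumes p: "p ` {..<n} \<subseteq> carrier_vec d" "inj_on p {..<n}"
    and l: "0 < l" "l < n" and \<epsilon>: "0 < \<epsilon>" "\<epsilon> < 1 / 2"
    and dist: "low_distortion (\<epsilon> / 5) n p (W R p)"
    and T: "T \<in> dimred_outputs n l p R"
begin

lemma dim_p: "i < n \<Longrightarrow> dim_vec (p i) = d"
  using p(1) by auto

lemma output_props: "greedy_set (W R p) n T" "card T = l" "T \<subseteq> {..<n}" "finite T" "T \<noteq> {}"
  using T l greedy_set_props[of "W R p" n T] finite_subset[of T "{..<n}"]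
  by (auto simp: dimred_outputs_def)

lemma output_pigeonhole:
  assumes "v < n" "\<forall>q\<in>T. (1 + \<epsilon> / 5) * s < W R p q v" "0 \<le> s"
    and "\<forall>i<n. cls i \<in> K" "finite K" "card K \<le> l"
  shows "\<exists>x<n. \<exists>y<n. x \<noteq> y \<and> cls x = cls y \<and> s < real (ham (p x) (p y))"
  using assms output_props \<epsilon>
  by (intro greedy_set_pigeonhole[OF output_props(1) _ dist]) (auto intro: W_commute simp: dim_p)

lemma W_gt:
  assumes "q < n" "v < n" "0 \<le> s" "(1 + \<epsilon> / 2) * s < real (ham (p q) (p v))"
  shows "(1 + \<epsilon> / 5) * s < W R p q v"
  using distortion_ratio[OF \<epsilon> assms(3,4)] dist assms(1,2) unfolding low_distortion_def by fastforce

text \<open>Points are classified by an optimal center within the optimal radius \<open>r\<close>. A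
  point too far from all chosen centers would yield two points of one class at distance above
  \<open>2 * r\<close>, against the triangle inequality.\<close>

lemma output_center_cost:
  "real (center_cost (p ` {..<n}) (p ` T)) \<le> (2 + \<epsilon>) * real (opt_center d l (p ` {..<n}))"
proof (rule ccontr)
  define r where "r = opt_center d l (p ` {..<n})"
  assume "\<not> ?thesis"
  then have far: "(2 + \<epsilon>) * real r < real (center_cost (p ` {..<n}) (p ` T))"
    by (simp add: r_def)
  have "center_cost (p ` {..<n}) (p ` T) \<in> (\<lambda>v. Min ((\<lambda>u. ham v u) ` p ` T)) ` p ` {..<n}"
    unfolding center_cost_def by (rule Max_in) (use l in auto)
  then obtain v where v: "v < n" "center_cost (p ` {..<n}) (p ` T) = Min ((\<lambda>u. ham (p v) u) ` p ` T)"
    by auto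
  \<comment> \<open>The threshold for the pigeonhole argument is \<open>2 * r\<close>, because (2 +
    \<epsilon>) r = (1 + \<epsilon>/2) (2 r).\<close>
  have "\<forall>q\<in>T. (1 + \<epsilon> / 5) * (2 * real r) < W R p q v"
  proof
    fix q assume q: "q \<in> T"
    then have "q < n" using output_props by auto
    have "center_cost (p ` {..<n}) (p ` T) \<le> ham (p v) (p q)"
      using v q output_props by (auto intro!: Min_le)
    also have "\<dots> = ham (p q) (p v)"
      using \<open>q < n\<close> v by (intro ham_commute) (simp add: dim_p)
    finally have "(2 + \<epsilon>) * real r < real (ham (p q) (p v))"
      using far by linarith
    then have "(1 + \<epsilon> / 2) * (2 * real r) < real (ham (p q) (p v))"
      by (simp add: algebra_simps)
    then show "(1 + \<epsilon> / 5) * (2 * real r) < W R p q v"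
      using W_gt \<open>q < n\<close> v by auto
  qed
  moreover obtain C where C: "C \<subseteq> carrier_vec d" "card C = l" "center_cost (p ` {..<n}) C = r"
    unfolding r_def using opt_center_attained[of "p ` {..<n}" d l] p l by (auto simp: card_image)
  have "finite C" using C(2) l by (simp add: card_ge_0_finite)
  have "\<forall>i<n. \<exists>c\<in>C. ham (p i) c \<le> r"
  proof (intro allI impI)
    fix i assume "i < n"
    then have "Min ((\<lambda>u. ham (p i) u) ` C) \<le> r"
      unfolding C(3)[symmetric] center_cost_def by (intro Max_ge) auto
    moreover have "Min ((\<lambda>u. ham (p i) u) ` C) \<in> (\<lambda>u. ham (p i) u) ` C"
      using \<open>finite C\<close> C(2) l by (intro Min_in) auto
    ultimately show "\<exists>c\<in>C. ham (p i) c \<le> r" by auto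
  qed
  then obtain c where c: "\<And>i. i < n \<Longrightarrow> c i \<in> C \<and> ham (p i) (c i) \<le> r" by metis
  ultimately obtain x y where xy: "x < n" "y < n" "c x = c y" "2 * real r < real (ham (p x) (p y))"
    using output_pigeonhole[of v "2 * real r" c C] v \<open>finite C\<close> C(2) by auto
  have "ham (p x) (p y) \<le> ham (p x) (c x) + ham (c x) (p y)"
    using xy(1) c[OF xy(1)] C(1) by (intro ham_triangle) (auto simp: dim_p)
  also have "ham (c x) (p y) = ham (p y) (c y)"
    unfolding xy(3) using xy(2) c[OF xy(2)] C(1) by (intro ham_commute) (auto simp: dim_p)
  also have "ham (p x) (c x) + ham (p y) (c y) \<le> r + r"
    using c[OF xy(1)] c[OF xy(2)] by (intro add_mono) simp_all
  finally show False using xy by simp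
qed

context
  fixes a :: "nat \<Rightarrow> nat"
  assumes a: "nearest_assignment n p R T a"
begin

text \<open>Distinct points have positive Hamming distance and hence positive \<open>W\<close>,
  while \<open>W R p i i\<close> is at most 0. So each cluster contains its own center.\<close>

lemma assignment_self: "i \<in> T \<Longrightarrow> a i = i"
proof (rule ccontr)
  assume i: "i \<in> T" "a i \<noteq> i"
  then have n: "i < n" "a i \<in> T" using a output_props by (auto simp: nearest_assignment_def)
  then have "a i < n" using output_props by auto
  then have "p (a i) \<noteq> p i" using i n p(2) by (auto simp: inj_on_def)
  then have "0 < ham (p (a i)) (p i)"
    using n \<open>a i < n\<close> by (intro ham_pos) (simp_all add: dim_p)
  then have "0 < W R p (a i) i"
    using W_gt[of "a i" i 0] n \<open>a i < n\<close> by simp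
  also have "W R p (a i) i \<le> W R p i i"
    using a i n by (auto simp: nearest_assignment_def)
  also have "W R p i i \<le> 0"
    using dist n unfolding low_distortion_def by fastforce
  finally show False by simp
qed

lemma assignment_in: "j < n \<Longrightarrow> a j \<in> T"
  using a by (simp add: nearest_assignment_def)

text \<open>Each center lies in its own cluster only, so distinct centers have distinct
  clusters.\<close>

lemma card_clusters: "card (clusters n p T a) = l"
proof -
  have "inj_on (\<lambda>i. p ` {j. j < n \<and> a j = i}) T"
  proof (rule inj_onI)
    fix i i' assume i: "i \<in> T" "i' \<in> T" "p ` {j. j < n \<and> a j = i} = p ` {j. j < n \<and> a j = i'}"
    have "i < n" using i output_props by auto
    then have "p i \<in> p ` {j. j < n \<and> a j = i}" using \<open>i < n\<close> assignment_self[OF i(1)] by auto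
    then have "p i \<in> p ` {j. j < n \<and> a j = i'}" unfolding i(3) .
    then obtain j where "j < n" "a j = i'" "p i = p j" by auto
    moreover from this have "i = j" using inj_onD[OF p(2)] \<open>i < n\<close> by simp
    ultimately show "i = i'" using assignment_self[OF i(1)] by simp
  qed
  then show ?thesis unfolding clusters_def using output_props by (simp add: card_image)
qed

lemma partition_on_clusters: "partition_on (p ` {..<n}) (clusters n p T a)"
proof (rule partition_onI)
  show "\<Union> (clusters n p T a) = p ` {..<n}"
    using assignment_in by (auto simp: clusters_def)
  show "disjnt C D" if "C \<in> clusters n p T a" "D \<in> clusters n p T a" "C \<noteq> D" for C D
    using that p(2) by (auto simp: clusters_def disjnt_iff inj_on_def)
  show "{} \<notin> clusters n p T a"
    using assignment_self output_props by (force simp: clusters_def)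
qed

text \<open>\<open>W\<close> is a squared distance and violates the triangle inequality, which is therefore applied to
  the Hamming distance before passing to \<open>W\<close>.\<close>

lemma output_diameter:
  "real (max_diameter (clusters n p T a)) \<le> (2 + \<epsilon>) * real (opt_diam l (p ` {..<n}))"
proof (rule ccontr)
  define D where "D = opt_diam l (p ` {..<n})"
  assume "\<not> ?thesis"
  then have far: "(2 + \<epsilon>) * real D < real (max_diameter (clusters n p T a))"
    by (simp add: D_def)
  have "finite (clusters n p T a)" "clusters n p T a \<noteq> {}"
    "\<forall>C\<in>clusters n p T a. finite C \<and> C \<noteq> {}"
    using output_props partition_onD3[OF partition_on_clusters] by (auto simp: clusters_def)
  then obtain C u v where uv: "C \<in> clusters n p T a" "u \<in> C" "v \<in> C"
      "max_diameter (clusters n p T a) = ham u v"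
    by (rule max_diameter_attained)
  then obtain i x y where xy: "i \<in> T" "x < n" "y < n" "a x = i" "a y = i" "u = p x" "v = p y"
    by (auto simp: clusters_def)
  have "i < n" using xy output_props by auto
  have "ham u v \<le> ham (p x) (p i) + ham (p i) (p y)"
    unfolding xy using xy \<open>i < n\<close> by (intro ham_triangle) (simp add: dim_p)
  also have "ham (p x) (p i) = ham (p i) (p x)"
    using xy \<open>i < n\<close> by (intro ham_commute) (simp add: dim_p)
  finally have "(2 + \<epsilon>) * real D < real (ham (p i) (p x)) + real (ham (p i) (p y))"
    using far uv(4) by linarith
  \<comment> \<open>Two points of a cluster are joined through their common center, so one of them
    is at more than half the distance from it.\<close>
  then have "(1 + \<epsilon> / 2) * real D < real (ham (p i) (p x)) \<or> (1 + \<epsilon> / 2) * real D < real (ham (p i) (p y))"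
    by (simp add: algebra_simps) linarith
  then obtain z where z: "z < n" "a z = i" "(1 + \<epsilon> / 2) * real D < real (ham (p i) (p z))"
    using xy by blast
  \<comment> \<open>\<open>i\<close> minimizes the weight to \<open>z\<close> among the centers, so
    the bound for \<open>i\<close> passes to every \<open>q\<close> in \<open>T\<close>.\<close>
  have "\<forall>q\<in>T. (1 + \<epsilon> / 5) * real D < W R p q z"
    using W_gt[OF \<open>i < n\<close> z(1) _ z(3)] a z by (force simp: nearest_assignment_def)
  moreover obtain Q where Q: "partition_on (p ` {..<n}) Q" "card Q = l" "max_diameter Q = D"
    unfolding D_def using opt_diam_attained[OF partition_on_clusters card_clusters] by blast
  have "finite Q" using Q(2) l by (simp add: card_ge_0_finite)
  have "\<forall>j<n. \<exists>B\<in>Q. p j \<in> B"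
    using partition_onD1[OF Q(1)] by auto
  then obtain c where c: "\<And>j. j < n \<Longrightarrow> c j \<in> Q \<and> p j \<in> c j" by metis
  ultimately obtain s t where st: "s < n" "t < n" "c s = c t" "real D < real (ham (p s) (p t))"
    using output_pigeonhole[of z "real D" c Q] z \<open>finite Q\<close> Q(2) by auto
  have "finite (c s)"
    using partition_onD1[OF Q(1)] c[OF st(1)] by (metis Union_upper finite_imageI finite_lessThan finite_subset)
  then have "ham (p s) (p t) \<le> D"
    using ham_le_max_diameter[OF \<open>finite Q\<close>, of "c s" "p s" "p t"] c[OF st(1)] c[OF st(2)] st(3) Q(3)
    by simp
  then show False using st by simp
qed

end

end

section \<open>Running time and correctness of the program\<close>

text \<open>Total correctness with a step budget \<open>T\<close>; as execution is deterministic,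
  the run that is asserted to exist is the only one.\<close>

definition runs :: "com \<Rightarrow> state \<Rightarrow> nat \<Rightarrow> (state \<Rightarrow> bool) \<Rightarrow> bool" where
  "runs c s T Q \<longleftrightarrow> (\<exists>t s'. big_step c s t s' \<and> t \<le> T \<and> Q s')"

inductive_cases IfE: "big_step (If b c1 c2) s t s'"

lemma runs_iff: "big_step c s t s' \<Longrightarrow> runs c s T Q \<longleftrightarrow> t \<le> T \<and> Q s'"
  unfolding runs_def using big_step_deterministic by blast

lemmas runs_Skip = runs_iff[OF big_step.Skip]
  and runs_NAssign = runs_iff[OF big_step.NAssign]
  and runs_RAssign = runs_iff[OF big_step.RAssign]
  and runs_Flip = runs_iff[OF big_step.Flip]

lemma runs_Seq:
  assumes "runs c1 s T1 (\<lambda>s'. runs c2 s' T2 Q)" "T1 + T2 \<le> T"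
  shows "runs (c1 ;; c2) s T Q"
  using assms unfolding runs_def by (meson add_mono big_step.Seq order.trans)

lemma runs_mono: "runs c s T Q \<Longrightarrow> T \<le> T' \<Longrightarrow> (\<And>s'. Q s' \<Longrightarrow> Q' s') \<Longrightarrow> runs c s T' Q'"
  unfolding runs_def by (meson order.trans)

text \<open>Budgets are subtracted while the program is read from left to right: \<open>c1\<close>
  uses \<open>Tm\<close> and the rest remains for \<open>c2\<close>.\<close>

lemma runs_Seq_spec:
  assumes "runs c1 s Tm Qm" "Tm \<le> T" "\<And>s'. Qm s' \<Longrightarrow> runs c2 s' (T - Tm) Q"
  shows "runs (c1 ;; c2) s T Q"
  by (rule runs_Seq[of _ _ Tm _ "T - Tm"]) (use assms in \<open>auto elim: runs_mono\<close>)

lemma runs_NAssign_Seq: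
  "1 + ncost i + ncost a \<le> T \<and> runs c (nset x (nval i s) (nval a s) s) (T - (1 + ncost i + ncost a)) Q
    \<Longrightarrow> runs (NAssign x i a ;; c) s T Q"
  by (rule runs_Seq_spec[where Tm = "1 + ncost i + ncost a" and Qm = "\<lambda>s'. s' = nset x (nval i s) (nval a s) s"])
    (simp_all add: runs_NAssign)

lemma runs_RAssign_Seq:
  "1 + ncost i + rcost e \<le> T \<and> runs c (rset x (nval i s) (rval e s) s) (T - (1 + ncost i + rcost e)) Q
    \<Longrightarrow> runs (RAssign x i e ;; c) s T Q"
  by (rule runs_Seq_spec[where Tm = "1 + ncost i + rcost e" and Qm = "\<lambda>s'. s' = rset x (nval i s) (rval e s) s"])
    (simp_all add: runs_RAssign)

lemma big_step_If:
  "big_step (If b c1 c2) s t s' \<longleftrightarrow>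
    (\<exists>t'. t = 1 + bcost b + t' \<and> big_step (if bval b s then c1 else c2) s t' s')"
  using big_step.IfTrue[of b s c1 _ s' c2] big_step.IfFalse[of b s c2 _ s' c1]
  by (auto elim!: IfE split: if_splits)

lemma runs_If:
  "runs (If b c1 c2) s T Q \<longleftrightarrow>
    1 + bcost b \<le> T \<and> runs (if bval b s then c1 else c2) s (T - (1 + bcost b)) Q"
proof
  assume "runs (If b c1 c2) s T Q"
  then obtain t s' where "big_step (if bval b s then c1 else c2) s t s'" "1 + bcost b + t \<le> T" "Q s'"
    unfolding runs_def big_step_If by blast
  then show "1 + bcost b \<le> T \<and> runs (if bval b s then c1 else c2) s (T - (1 + bcost b)) Q"
    unfolding runs_def by (intro conjI exI[of _ t] exI[of _ s']) simp_all
next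
  assume *: "1 + bcost b \<le> T \<and> runs (if bval b s then c1 else c2) s (T - (1 + bcost b)) Q"
  then obtain t s' where t: "big_step (if bval b s then c1 else c2) s t s'" "t \<le> T - (1 + bcost b)" "Q s'"
    unfolding runs_def by blast
  then have "big_step (If b c1 c2) s (1 + bcost b + t) s'"
    unfolding big_step_If by blast
  from runs_iff[OF this] show "runs (If b c1 c2) s T Q" using t conjunct1[OF *] by simp
qed

text \<open>\<open>I i\<close> describes the state after \<open>i\<close> rounds, of which there are
  exactly \<open>N\<close>. A round pays for the test and the body; the final
  \<open>1 + bcost b\<close> is the failing test.\<close>

lemma runs_While:
  assumes init: "I 0 s"
    and step: "\<And>i s'. i < N \<Longrightarrow> I i s' \<Longrightarrow> bval b s' \<and> runs c s' B (I (Suc i))"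
    and stop: "\<And>s'. I N s' \<Longrightarrow> \<not> bval b s' \<and> Q s'"
    and T: "N * (1 + bcost b + B) + 1 + bcost b \<le> T"
  shows "runs (While b c) s T Q"
proof -
  \<comment> \<open>Backward induction from \<open>i = N\<close>, with the budget for the remaining
    \<open>N - i\<close> rounds.\<close>
  have "runs (While b c) s' ((N - i) * (1 + bcost b + B) + 1 + bcost b) Q" if "i \<le> N" "I i s'" for i s'
    using that
  proof (induction arbitrary: s' rule: inc_induct)
    case base
    then show ?case using stop runs_iff[OF big_step.WhileFalse[of b s' c]] by simp
  next
    case (step i)
    obtain t1 s1 where 1: "bval b s'" "big_step c s' t1 s1" "t1 \<le> B" "I (Suc i) s1"
      using assms(2)[of i s'] step.hyps step.prems unfolding runs_def by blast
    obtain t2 s2 where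
      2: "big_step (While b c) s1 t2 s2" "t2 \<le> (N - Suc i) * (1 + bcost b + B) + 1 + bcost b" "Q s2"
      using step.IH[OF 1(4)] unfolding runs_def by blast
    have "N - i = Suc (N - Suc i)" using step.hyps by simp
    then have "1 + bcost b + t1 + t2 \<le> (N - i) * (1 + bcost b + B) + 1 + bcost b"
      using 1 2 by simp
    with 2 show ?case unfolding runs_iff[OF big_step.WhileTrue[OF 1(1,2) 2(1)]] by simp
  qed
  from runs_mono[OF this[OF _ init]] T show ?thesis by simp
qed

lemma nset_simps [simp]:
  "nmem (nset x i v s) = (nmem s)(x := (nmem s x)(i := v))"
  "rmem (nset x i v s) = rmem s" "coins (nset x i v s) = coins s"
  "rmem (rset x i u s) = (rmem s)(x := (rmem s x)(i := u))"
  "nmem (rset x i u s) = nmem s" "coins (rset x i u s) = coins s"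
  by (simp_all add: nset_def rset_def)

text \<open>A round costs 6 steps for the test and 6 for the increment besides the body, hence 12.
  The 9 covers initialization (3) and the last test (6). The body must leave the counter
  unchanged.\<close>

lemma runs_For:
  assumes init: "J 0 (nset x 0 0 s)"
    and bound: "\<And>i s'. i \<le> N \<Longrightarrow> J i s' \<Longrightarrow> nmem s' y 0 = N"
    and body: "\<And>i s'. i < N \<Longrightarrow> J i s' \<Longrightarrow> nmem s' x 0 = i \<Longrightarrow>
      runs c s' B (\<lambda>s''. nmem s'' x 0 = i \<and> J (Suc i) (nset x 0 (Suc i) s''))"
    and final: "\<And>s'. J N s' \<Longrightarrow> Q s'"
    and T: "N * (B + 12) + 9 \<le> T"
  shows "runs (For x (nv y) c) s T Q"
proof -
  let ?b = "NLess (nv x) (nv y)"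
  have "runs (While ?b (c ;; nlet x (NAdd (nv x) (NatC 1)))) (nset x 0 0 s)
      (N * (1 + bcost ?b + (B + 6)) + 1 + bcost ?b) Q"
  proof (rule runs_While[where I = "\<lambda>i s'. J i s' \<and> nmem s' x 0 = i"])
    show "J 0 (nset x 0 0 s) \<and> nmem (nset x 0 0 s) x 0 = 0" using init by simp
    show "bval ?b s' \<and> runs (c ;; nlet x (NAdd (nv x) (NatC 1))) s' (B + 6)
        (\<lambda>s'. J (Suc j) s' \<and> nmem s' x 0 = Suc j)"
      if "j < N" "J j s' \<and> nmem s' x 0 = j" for j s'
    proof
      show "bval ?b s'" using that bound[of j s'] by simp
      show "runs (c ;; nlet x (NAdd (nv x) (NatC 1))) s' (B + 6)
          (\<lambda>s'. J (Suc j) s' \<and> nmem s' x 0 = Suc j)"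
        by (rule runs_Seq_spec[OF body[of j]]) (use that in \<open>auto simp: runs_NAssign\<close>)
    qed
    show "\<not> bval ?b s' \<and> Q s'" if "J N s' \<and> nmem s' x 0 = N" for s'
      using that bound[of N s'] final by simp
  qed simp
  then show ?thesis
    unfolding For_def
    by (intro runs_NAssign_Seq conjI) (use T in \<open>auto elim!: runs_mono simp: algebra_simps\<close>)
qed

section \<open>The phases of the program\<close>

text \<open>A modifies clause, which lets loop invariants carry all untouched memory at once. The
  coin list is unconstrained, so drawing signs respects it too.\<close>

definition frame :: "string set \<Rightarrow> string set \<Rightarrow> state \<Rightarrow> state \<Rightarrow> bool" where
  "frame X Y s s' \<longleftrightarrow> (\<forall>x. x \<notin> X \<longrightarrow> nmem s' x = nmem s x) \<and> (\<forall>y. y \<notin> Y \<longrightarrow> rmem s' y = rmem s y)"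

lemma frame_refl [simp]: "frame X Y s s"
  by (simp add: frame_def)

lemma frame_nmem: "frame X Y s s' \<Longrightarrow> x \<notin> X \<Longrightarrow> nmem s' x = nmem s x"
  and frame_rmem: "frame X Y s s' \<Longrightarrow> y \<notin> Y \<Longrightarrow> rmem s' y = rmem s y"
  by (simp_all add: frame_def)

lemma frame_trans: "frame X Y s s' \<Longrightarrow> frame X' Y' s' s'' \<Longrightarrow> X \<union> X' \<subseteq> X'' \<Longrightarrow> Y \<union> Y' \<subseteq> Y'' \<Longrightarrow> frame X'' Y'' s s''"
  unfolding frame_def by (metis UnCI subset_iff)


lemma frame_set:
  "frame X Y s s' \<Longrightarrow> x \<in> X \<Longrightarrow> frame X Y s (nset x i v s')"
  "frame X Y s s' \<Longrightarrow> y \<in> Y \<Longrightarrow> frame X Y s (rset y i u s')"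
  "frame X Y s s' \<Longrightarrow> frame X Y s (s'\<lparr>coins := cs\<rparr>)"
  by (auto simp: frame_def)

text \<open>The weight \<open>W\<close> as read off from the array \<open>F\<close> of projected
  points; \<open>W_eq_sqdist\<close> links the two.\<close>

definition sqdist :: "state \<Rightarrow> nat \<Rightarrow> nat \<Rightarrow> nat \<Rightarrow> real" where
  "sqdist s k q m = (\<Sum>r<k. (rmem s ''F'' (q * k + r) - rmem s ''F'' (m * k + r))\<^sup>2)"

lemma runs_compute_W:
  assumes "nmem s ''k'' 0 = k"
  shows "runs compute_W s (43 * k + 12) (\<lambda>s'. frame {''r''} {''w'', ''z''} s s' \<and>
    rmem s' ''w'' 0 = sqdist s k (nmem s ''q'' 0) (nmem s ''m'' 0))"
  unfolding compute_W_def sqdist_def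
  apply (rule runs_RAssign_Seq, rule conjI, simp)
  \<comment> \<open>The two assignments of a round cost 21 and 10 steps, and the invariant is the
    partial sum over the first \<open>i\<close> coordinates.\<close>
  apply (rule runs_For[where N = k and B = 31 and J = "\<lambda>i s'. frame {''r''} {''w'', ''z''} s s' \<and>
    rmem s' ''w'' 0 = (\<Sum>r<i. (rmem s ''F'' (nmem s ''q'' 0 * k + r) - rmem s ''F'' (nmem s ''m'' 0 * k + r))\<^sup>2)"])
  subgoal by (simp add: frame_set)
  subgoal using assms by (auto simp: frame_nmem)
  subgoal premises prems for i s'
  proof -
    have fr: "frame {''r''} {''w'', ''z''} s s'" using prems by blast
    show ?thesis
      apply (rule runs_RAssign_Seq, rule conjI, simp)
      using prems assms fr
      by (simp add: runs_RAssign frame_set frame_nmem[OF fr] frame_rmem[OF fr] power2_eq_square)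
  qed
  subgoal by simp
  subgoal by simp
  done

text \<open>Justifies rounding by counting: the test \<open>i < x\<close> first fails at the
  rounded-up value, also when \<open>x\<close> is negative.\<close>

lemma less_nat_ceiling_iff: "i < nat \<lceil>x\<rceil> \<longleftrightarrow> real i < x"
  by (simp add: zless_nat_eq_int_zless less_ceiling_iff)

lemma runs_compute_k:
  assumes "nmem s ''n'' 0 = n" "rmem s ''delta'' 0 = \<delta>"
    and k_def: "k = target_dim c n \<delta>"
  shows "runs (compute_k c) s (13 * k + 24) (\<lambda>s'. frame {''k''} {''x''} s s' \<and> nmem s' ''k'' 0 = k
    \<and> coins s' = coins s)"
proof -
  define x where "x = c * ln (real n) / \<delta>\<^sup>2"
  have less_k: "i < k \<longleftrightarrow> real i < x" for i
    unfolding k_def x_def target_dim_def by (rule less_nat_ceiling_iff)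
  show ?thesis
    unfolding compute_k_def
    apply (rule runs_RAssign_Seq, rule conjI, simp)
    apply (rule runs_NAssign_Seq, rule conjI, simp)
    apply (rule runs_While[where N = k and B = 6 and I = "\<lambda>i s'. frame {''k''} {''x''} s s' \<and> nmem s' ''k'' 0 = i
        \<and> rmem s' ''x'' 0 = x \<and> coins s' = coins s"])
    subgoal using assms(1,2) by (simp add: frame_set x_def power2_eq_square)
    subgoal by (auto simp: runs_NAssign frame_set simp flip: less_k)
    subgoal by (auto simp flip: less_k)
    subgoal by simp
    done
qed

lemma runs_draw_matrix:
  assumes "nmem s ''k'' 0 = k" "nmem s ''d'' 0 = d" and len: "length (coins s) = k * d"
  shows "runs draw_matrix s (21 * (k * d) + 21 * k + 9) (\<lambda>s'. frame {''r'', ''t''} {''R''} s s' \<and>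
    (\<forall>a<k * d. rmem s' ''R'' a = coins s ! a))"
  unfolding draw_matrix_def
  apply (rule runs_For[where N = k and B = "21 * d + 9" and J = "\<lambda>i s'. frame {''r'', ''t''} {''R''} s s' \<and>
    (\<forall>a<i * d. rmem s' ''R'' a = coins s ! a) \<and> coins s' = drop (i * d) (coins s)"])
  subgoal by (simp add: frame_set)
  subgoal using assms by (auto simp: frame_nmem)
  subgoal premises prems for i s'
    apply (rule runs_For[where N = d and B = 9 and J = "\<lambda>j s''. frame {''r'', ''t''} {''R''} s s'' \<and> nmem s'' ''r'' 0 = i \<and>
      (\<forall>a<i * d + j. rmem s'' ''R'' a = coins s ! a) \<and> coins s'' = drop (i * d + j) (coins s)"])
    subgoal using prems by (simp add: frame_set)
    subgoal using assms by (auto simp: frame_nmem)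
    subgoal premises p2 for j s''
    proof -
      have fr: "frame {''r'', ''t''} {''R''} s s''" using p2 by blast
      \<comment> \<open>Some coin outcomes are left, so \<open>Flip\<close> is not stuck.\<close>
      have "i * d + j < k * d"
      proof -
        have "i * d + j < Suc i * d" using p2 by simp
        also have "\<dots> \<le> k * d" using prems(1) by (intro mult_right_mono) auto
        finally show ?thesis .
      qed
      then have c: "coins s'' = coins s ! (i * d + j) # drop (Suc (i * d + j)) (coins s)"
        using p2 len by (simp add: Cons_nth_drop_Suc)
      show ?thesis
        using p2 assms fr
        by (auto simp: runs_Flip[OF c] frame_set frame_nmem[OF fr] less_Suc_eq)
    qed
    subgoal using prems by (auto simp: frame_set algebra_simps)
    subgoal by simp
    done
  subgoal by simp
  subgoal by (simp add: algebra_simps)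
  done

text \<open>Rows occupy increasing, disjoint address ranges, so writing into one row preserves the
  earlier ones.\<close>

lemma row_major_less: "i * w + j < i' * w + (j' :: nat)" if "i < i'" "j < w"
proof -
  have "i * w + j < Suc i * w" using that by simp
  also have "\<dots> \<le> i' * w" using that by (intro mult_right_mono) auto
  finally show ?thesis by simp
qed

lemma runs_project_points:
  assumes n: "nmem s ''n'' 0 = n" "nmem s ''k'' 0 = k" "nmem s ''d'' 0 = d"
  defines "g \<equiv> \<lambda>i r. 1 / sqrt (real k) * (\<Sum>t<d. rmem s ''R'' (r * d + t) * rmem s ''P'' (i * d + t))"
  shows "runs project_points s (n * (k * (36 * d + 42) + 21) + 9)
    (\<lambda>s'. frame {''i'', ''r'', ''t''} {''y'', ''F''} s s' \<and> (\<forall>i<n. \<forall>r<k. rmem s' ''F'' (i * k + r) = g i r))"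
  unfolding project_points_def
  apply (rule runs_For[where N = n and B = "k * (36 * d + 42) + 9" and
    J = "\<lambda>i s'. frame {''i'', ''r'', ''t''} {''y'', ''F''} s s' \<and> (\<forall>i'<i. \<forall>r<k. rmem s' ''F'' (i' * k + r) = g i' r)"])
  subgoal by (simp add: frame_set)
  subgoal using n by (auto simp: frame_nmem)
  subgoal premises prems for i s'
    apply (rule runs_For[where N = k and B = "36 * d + 30" and
      J = "\<lambda>r s'. frame {''i'', ''r'', ''t''} {''y'', ''F''} s s' \<and> nmem s' ''i'' 0 = i \<and>
        (\<forall>i'<i. \<forall>r<k. rmem s' ''F'' (i' * k + r) = g i' r) \<and> (\<forall>r'<r. rmem s' ''F'' (i * k + r') = g i r')"])
    subgoal using prems by (simp add: frame_set)
    subgoal using n by (auto simp: frame_nmem)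
    subgoal premises p2 for r s'
    proof -
      have fr: "frame {''i'', ''r'', ''t''} {''y'', ''F''} s s'" using p2 by blast
      show ?thesis
        apply (rule runs_RAssign_Seq, rule conjI, simp)
        apply (rule runs_Seq_spec[where Tm = "36 * d + 9" and
          Qm = "\<lambda>s''. frame {''t''} {''y''} s' s'' \<and>
            rmem s'' ''y'' 0 = (\<Sum>t<d. rmem s ''R'' (r * d + t) * rmem s ''P'' (i * d + t))"])
        subgoal
          apply (rule runs_For[where N = d and B = 24 and
            J = "\<lambda>t s''. frame {''t''} {''y''} s' s'' \<and>
            rmem s'' ''y'' 0 = (\<Sum>t<t. rmem s ''R'' (r * d + t) * rmem s ''P'' (i * d + t))"])
          subgoal by (simp add: frame_set)
          subgoal using n by (auto simp: frame_nmem[OF fr] frame_nmem)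
          subgoal premises p3 for t s''
          proof -
            have fr': "frame {''t''} {''y''} s' s''" using p3 by blast
            show ?thesis using p2 p3 n fr'
              by (simp add: runs_RAssign frame_set frame_nmem[OF fr'] frame_rmem[OF fr']
                  frame_nmem[OF fr] frame_rmem[OF fr])
          qed
          subgoal by simp
          subgoal by simp
          done
        subgoal by simp
        subgoal premises p3 for s''
        proof -
          have fr': "frame {''t''} {''y''} s' s''" using p3 by blast
          have "frame {''i'', ''r'', ''t''} {''y'', ''F''} s s''"
            by (rule frame_trans[OF fr fr']) auto
          \<comment> \<open>The entry written now overwrites no projection of an earlier
            point.\<close>
          moreover have "i' * k + r' \<noteq> i * k + r" if "i' < i" "r' < k" for i' r'
            using row_major_less[OF that, of r] by simp
          ultimately show ?thesis using p2 p3 n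
            by (auto simp: runs_RAssign frame_set frame_nmem[OF fr'] frame_rmem[OF fr']
                  frame_nmem[OF fr] frame_rmem[OF fr] g_def less_Suc_eq)
        qed
        done
    qed
    subgoal using prems by (auto simp: frame_set less_Suc_eq)
    subgoal by simp
    done
  subgoal by simp
  subgoal by (simp add: algebra_simps)
  done

lemma sqdist_frame: "frame X Y s s' \<Longrightarrow> ''F'' \<notin> Y \<Longrightarrow> sqdist s' k q m = sqdist s k q m"
  by (simp add: sqdist_def frame_rmem)

definition chosen :: "state \<Rightarrow> nat \<Rightarrow> nat set" where
  "chosen s j = nmem s ''T'' ` {..<j}"

text \<open>The weights refer to the state \<open>s0\<close> before the selection phase;
  \<open>F\<close> is not among the modified arrays, so they stay valid. The cardinality condition
  records that no index is listed twice.\<close>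

definition greedy_inv :: "nat \<Rightarrow> nat \<Rightarrow> state \<Rightarrow> nat \<Rightarrow> state \<Rightarrow> bool" where
  "greedy_inv n k s0 j s \<longleftrightarrow>
     frame {''r'', ''q'', ''m'', ''T'', ''inT'', ''size'', ''found''} {''w'', ''z'', ''D''} s0 s \<and>
     nmem s ''size'' 0 = j \<and> greedy_set (sqdist s0 k) n (chosen s j) \<and> card (chosen s j) = j \<and>
     (\<forall>m<n. nmem s ''inT'' m = (if m \<in> chosen s j then 1 else 0)) \<and>
     (\<forall>m<n. rmem s ''D'' m = Min ((\<lambda>q. sqdist s0 k q m) ` chosen s j))"

lemma runs_first_center:
  assumes "nmem s ''n'' 0 = n" "nmem s ''k'' 0 = k" "0 < n"
  shows "runs first_center s (n * 16 + 9 + (n * (43 * k + 29) + 23)) (greedy_inv n k s 1)"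
proof -
  let ?X = "{''r'', ''q'', ''m'', ''T'', ''inT'', ''size'', ''found''}"
  let ?Y = "{''w'', ''z'', ''D''}"
  show ?thesis
    unfolding first_center_def
    apply (rule runs_Seq_spec[where Tm = "n * 16 + 9" and
      Qm = "\<lambda>s'. frame ?X ?Y s s' \<and> (\<forall>m<n. nmem s' ''inT'' m = 0)"])
    subgoal
      apply (rule runs_For[where N = n and B = 4 and
        J = "\<lambda>i s'. frame ?X ?Y s s' \<and> (\<forall>m<i. nmem s' ''inT'' m = 0)"])
      subgoal by (simp add: frame_set)
      subgoal using assms by (auto simp: frame_nmem)
      subgoal by (auto simp: runs_NAssign frame_set less_Suc_eq)
      subgoal by simp
      subgoal by simp
      done
    subgoal by (simp add: algebra_simps)
    subgoal premises prems for s'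
      apply (rule runs_NAssign_Seq, rule conjI, simp)
      apply (rule runs_NAssign_Seq, rule conjI, simp)
      apply (rule runs_NAssign_Seq, rule conjI, simp)
      apply (rule runs_NAssign_Seq, rule conjI, simp)
      apply (rule runs_For[where N = n and B = "43 * k + 17" and
        J = "\<lambda>i s'. frame ?X ?Y s s' \<and> nmem s' ''size'' 0 = 1 \<and> nmem s' ''q'' 0 = 0 \<and>
          nmem s' ''T'' 0 = 0 \<and> (\<forall>m<n. nmem s' ''inT'' m = (if m = 0 then 1 else 0)) \<and>
          (\<forall>m<i. rmem s' ''D'' m = sqdist s k 0 m)"])
      subgoal using prems by (simp add: frame_set)
      subgoal using assms by (auto simp: frame_nmem)
      subgoal premises p2 for i s''
      proof -
        have fr: "frame ?X ?Y s s''" using p2 by blast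
        show ?thesis
          apply (rule runs_Seq_spec[OF runs_compute_W[of _ k]])
          subgoal using assms by (simp add: frame_nmem[OF fr])
          subgoal by simp
          subgoal premises p3 for s3
          proof -
            have fr': "frame {''r''} {''w'', ''z''} s'' s3" using p3 by blast
            have fr'': "frame ?X ?Y s s3" by (rule frame_trans[OF fr fr']) auto
            show ?thesis using p2 p3 fr''
              by (auto simp: runs_RAssign frame_set frame_nmem[OF fr'] frame_rmem[OF fr']
                  sqdist_frame[OF fr] less_Suc_eq)
          qed
          done
      qed
      subgoal using assms(3) by (auto simp: greedy_inv_def chosen_def lessThan_Suc intro: greedy_set.start)
      subgoal by (simp add: algebra_simps)
      done
    done
qed

lemma runs_select_farthest:
  assumes n: "nmem s ''n'' 0 = n" and S: "\<forall>m<n. nmem s ''inT'' m = (if m \<in> S then 1 else 0)"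
    and ex: "{..<n} - S \<noteq> {}"
  shows "runs select_farthest s (35 * n + 12) (\<lambda>s'. frame {''m'', ''q'', ''found''} {} s s' \<and>
    nmem s' ''q'' 0 \<in> {..<n} - S \<and> (\<forall>m\<in>{..<n} - S. rmem s ''D'' m \<le> rmem s ''D'' (nmem s' ''q'' 0)))"
  unfolding select_farthest_def
  apply (rule runs_NAssign_Seq, rule conjI, simp)
  \<comment> \<open>Until \<open>found\<close> is set, only members of \<open>S\<close> have been
    seen; from then on \<open>q\<close> maximizes \<open>D\<close> among the candidates seen so
    far.\<close>
  apply (rule runs_For[where N = n and B = 23 and
    J = "\<lambda>i s'. frame {''m'', ''q'', ''found''} {} s s' \<and>
      (if nmem s' ''found'' 0 = 0 then {..<i} \<subseteq> S
       else nmem s' ''q'' 0 \<in> {..<n} - S \<and> (\<forall>m\<in>{..<i} - S. rmem s ''D'' m \<le> rmem s ''D'' (nmem s' ''q'' 0)))"])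
  subgoal by (simp add: frame_set)
  subgoal using n by (auto simp: frame_nmem)
  subgoal premises prems for i s'
  proof -
    have fr: "frame {''m'', ''q'', ''found''} {} s s'" using prems by blast
    have fr': "frame {''m'', ''q'', ''found''} {} s (nset ''m'' 0 (Suc i) s')"
      "frame {''m'', ''q'', ''found''} {} s (nset ''m'' 0 (Suc i) (nset ''q'' 0 i s'))"
      "frame {''m'', ''q'', ''found''} {} s (nset ''m'' 0 (Suc i) (nset ''found'' 0 (Suc 0) (nset ''q'' 0 i s')))"
      using fr by (auto intro!: frame_set)
    show ?thesis
    proof (cases "i \<in> S")
      case True
      then have "nmem s' ''inT'' i = 1" using S prems by (simp add: frame_nmem[OF fr])
      then show ?thesis using prems fr' True
        by (auto simp: runs_If runs_Skip lessThan_Suc)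
    next
      case False
      then have inT: "nmem s' ''inT'' i = 0" using S prems by (simp add: frame_nmem[OF fr])
      show ?thesis
      proof (cases "nmem s' ''found'' 0 = 0")
        case True
        have "runs (nlet ''q'' (nv ''m'') ;; nlet ''found'' (NatC 1)) s' 10
          (\<lambda>s''. s'' = nset ''found'' 0 1 (nset ''q'' 0 i s'))"
          using prems by (intro runs_NAssign_Seq) (simp add: runs_NAssign)
        then have "runs (nlet ''q'' (nv ''m'') ;; nlet ''found'' (NatC 1)) s' 10
          (\<lambda>s''. nmem s'' ''m'' 0 = i \<and> (frame {''m'', ''q'', ''found''} {} s (nset ''m'' 0 (Suc i) s'') \<and>
      (if nmem (nset ''m'' 0 (Suc i) s'') ''found'' 0 = 0 then {..<Suc i} \<subseteq> S
       else nmem (nset ''m'' 0 (Suc i) s'') ''q'' 0 \<in> {..<n} - S \<and> (\<forall>m\<in>{..<Suc i} - S. rmem s ''D'' m \<le> rmem s ''D'' (nmem (nset ''m'' 0 (Suc i) s'') ''q'' 0)))))"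
          by (rule runs_mono) (use prems fr' True \<open>i \<notin> S\<close> in \<open>auto simp: lessThan_Suc\<close>)
        then show ?thesis using prems inT True
          by (auto simp: runs_If elim!: runs_mono)
      next
        case False
        then show ?thesis using prems fr' inT \<open>i \<notin> S\<close>
          by (auto simp: runs_If runs_Skip runs_NAssign lessThan_Suc frame_rmem[OF fr] intro: order.trans)
      qed
    qed
  qed
  \<comment> \<open>A candidate exists, so \<open>found\<close> is nonzero at the end of the
    scan.\<close>
  subgoal using ex by (auto split: if_splits)
  subgoal by simp
  done

lemma runs_add_center:
  assumes nk: "nmem s0 ''n'' 0 = n" "nmem s0 ''k'' 0 = k"
    and inv: "greedy_inv n k s0 j s1" and j: "0 < j"
    and sel: "frame {''m'', ''q'', ''found''} {} s1 s" "nmem s ''q'' 0 = q" "q \<in> {..<n} - chosen s1 j"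
      "\<forall>m\<in>{..<n} - chosen s1 j. rmem s1 ''D'' m \<le> rmem s1 ''D'' q"
  shows "runs add_center s (n * (43 * k + 36) + 24) (greedy_inv n k s0 (Suc j))"
proof -
  let ?X = "{''r'', ''q'', ''m'', ''T'', ''inT'', ''size'', ''found''}"
  let ?Y = "{''w'', ''z'', ''D''}"
  let ?w = "sqdist s0 k"
  define S where "S = chosen s1 j"
  have fr1: "frame ?X ?Y s0 s1" using inv by (simp add: greedy_inv_def)
  have fr: "frame ?X ?Y s0 s" by (rule frame_trans[OF fr1 sel(1)]) auto
  have S: "finite S" "S \<noteq> {}" using j by (auto simp: S_def chosen_def)
  have greedy: "greedy_set ?w n (insert q S)"
    using inv sel by (intro greedy_set.add) (auto simp: greedy_inv_def S_def)
  have card: "card (insert q S) = Suc j"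
    using inv sel S by (simp add: greedy_inv_def S_def)
  have D: "rmem s ''D'' m = Min ((\<lambda>q. ?w q m) ` S)" if "m < n" for m
    using inv that by (simp add: greedy_inv_def S_def frame_rmem[OF sel(1)])
  have inT: "nmem s ''inT'' m = (if m \<in> S then 1 else 0)" if "m < n" for m
    using inv that by (simp add: greedy_inv_def S_def frame_nmem[OF sel(1)])
  have chosen: "chosen s'' (Suc j) = insert q S" if "nmem s'' ''T'' = (nmem s ''T'')(j := q)" for s''
    unfolding chosen_def that S_def lessThan_Suc by (auto simp: frame_nmem[OF sel(1)])
  have size: "nmem s ''size'' 0 = j"
    using inv by (simp add: greedy_inv_def frame_nmem[OF sel(1)])
  show ?thesis
    unfolding add_center_def
    apply (rule runs_NAssign_Seq, rule conjI, simp)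
    apply (rule runs_NAssign_Seq, rule conjI, simp)
    apply (rule runs_NAssign_Seq, rule conjI, simp)
    \<comment> \<open>The new center enters the minima in \<open>D\<close> one index at a time:
      those below \<open>i\<close> already account for \<open>q\<close>.\<close>
    apply (rule runs_For[where N = n and B = "43 * k + 24" and
      J = "\<lambda>i s'. frame ?X ?Y s0 s' \<and> nmem s' ''size'' 0 = Suc j \<and> nmem s' ''q'' 0 = q \<and>
        nmem s' ''T'' = (nmem s ''T'')(j := q) \<and>
        (\<forall>m<n. nmem s' ''inT'' m = (if m \<in> insert q S then 1 else 0)) \<and>
        (\<forall>m<n. rmem s' ''D'' m = Min ((\<lambda>q. ?w q m) ` (if m < i then insert q S else S)))"])
    subgoal using fr size sel inT D by (auto simp: frame_set)
    subgoal using nk by (auto simp: frame_nmem)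
    subgoal premises p2 for i s''
    proof -
      have fr2: "frame ?X ?Y s0 s''" using p2 by blast
      show ?thesis
        apply (rule runs_Seq_spec[OF runs_compute_W[of _ k]])
        subgoal using nk by (simp add: frame_nmem[OF fr2])
        subgoal by simp
        subgoal premises p3 for s3
        proof -
          have fr3: "frame {''r''} {''w'', ''z''} s'' s3" using p3 by blast
          have fr4: "frame ?X ?Y s0 s3" by (rule frame_trans[OF fr2 fr3]) auto
          have "Min ((\<lambda>q. ?w q i) ` insert q S) = min (?w q i) (Min ((\<lambda>q. ?w q i) ` S))"
            using S by simp
          then show ?thesis using p2 p3 fr4
            by (auto simp: runs_If runs_Skip runs_RAssign frame_set frame_nmem[OF fr3] frame_rmem[OF fr3]
                  sqdist_frame[OF fr2] less_Suc_eq min_def)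
        qed
        done
    qed
    subgoal for s'
      using greedy card chosen[of s'] by (auto simp: greedy_inv_def)
    subgoal by (simp add: algebra_simps)
    done
qed

lemma runs_greedy:
  assumes "nmem s ''n'' 0 = n" "nmem s ''k'' 0 = k" "nmem s ''l'' 0 = l" "0 < l" "l < n"
  shows "runs (first_center ;; While (NLess (nv ''size'') (nv ''l'')) (select_farthest ;; add_center)) s
    (n * 16 + 9 + (n * (43 * k + 29) + 23) + ((l - 1) * (43 * (n * k) + 71 * n + 42) + 6)) (greedy_inv n k s l)"
proof (rule runs_Seq_spec[OF runs_first_center])
  fix s1 assume s1: "greedy_inv n k s 1 s1"
  have l: "nmem s' ''l'' 0 = l" if "greedy_inv n k s j s'" for j s'
    using that assms(3) by (auto simp: greedy_inv_def frame_nmem)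
  show "runs (While (NLess (nv ''size'') (nv ''l'')) (select_farthest ;; add_center)) s1
    (n * 16 + 9 + (n * (43 * k + 29) + 23) + ((l - 1) * (43 * (n * k) + 71 * n + 42) + 6) - (n * 16 + 9 + (n * (43 * k + 29) + 23)))
    (greedy_inv n k s l)"
  \<comment> \<open>The loop starts with one center, hence the shift by one in the invariant and
    \<open>l - 1\<close> rounds.\<close>
  proof (rule runs_While[where I = "\<lambda>i. greedy_inv n k s (Suc i)" and N = "l - 1" and
        B = "35 * n + 12 + (n * (43 * k + 36) + 24)"])
    show "greedy_inv n k s (Suc 0) s1" using s1 by simp
    fix i s'
    assume i: "i < l - 1" and s': "greedy_inv n k s (Suc i) s'"
    have "card (chosen s' (Suc i)) = Suc i" using s' by (simp add: greedy_inv_def)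
    moreover have "finite (chosen s' (Suc i))" by (simp add: chosen_def)
    \<comment> \<open>Fewer than \<open>l < n\<close> indices are chosen, so a candidate
      remains.\<close>
    ultimately have ex: "{..<n} - chosen s' (Suc i) \<noteq> {}"
      using i assms(5) card_mono[of "chosen s' (Suc i)" "{..<n}"] by auto
    have "runs (select_farthest ;; add_center) s' (35 * n + 12 + (n * (43 * k + 36) + 24))
      (greedy_inv n k s (Suc (Suc i)))"
    proof (rule runs_Seq_spec[OF runs_select_farthest[OF _ _ ex]])
      show "nmem s' ''n'' 0 = n" "\<forall>m<n. nmem s' ''inT'' m = (if m \<in> chosen s' (Suc i) then 1 else 0)"
        using s' assms(1) by (auto simp: greedy_inv_def frame_nmem)
      fix s'' assume s'': "frame {''m'', ''q'', ''found''} {} s' s'' \<and>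
        nmem s'' ''q'' 0 \<in> {..<n} - chosen s' (Suc i) \<and>
        (\<forall>m\<in>{..<n} - chosen s' (Suc i). rmem s' ''D'' m \<le> rmem s' ''D'' (nmem s'' ''q'' 0))"
      show "runs add_center s'' (35 * n + 12 + (n * (43 * k + 36) + 24) - (35 * n + 12))
        (greedy_inv n k s (Suc (Suc i)))"
        using runs_add_center[OF assms(1,2) s', of s''] s'' by (simp add: add.commute)
    qed simp
    moreover have "nmem s' ''size'' 0 = Suc i" using s' by (simp add: greedy_inv_def)
    ultimately show "bval (NLess (nv ''size'') (nv ''l'')) s' \<and> runs (select_farthest ;; add_center) s'
        (35 * n + 12 + (n * (43 * k + 36) + 24)) (greedy_inv n k s (Suc (Suc i)))"
      using i l[OF s'] by simp
  next
    fix s' assume "greedy_inv n k s (Suc (l - 1)) s'"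
    then show "\<not> bval (NLess (nv ''size'') (nv ''l'')) s' \<and> greedy_inv n k s l s'"
      using l[of l s'] assms(4) by (simp add: greedy_inv_def)
  qed (simp add: algebra_simps)
qed (use assms in auto)

section \<open>The coin list as a matrix and the whole program\<close>

lemma length_row_major: "length (concat (map (\<lambda>i. map (f i) [0..<w]) [0..<h])) = h * w"
  by (induction h) auto

lemma nth_row_major:
  assumes "i < h" "j < w"
  shows "concat (map (\<lambda>i. map (f i) [0..<w]) [0..<h]) ! (i * w + j) = f i j"
  using assms
proof (induction h)
  case (Suc h)
  show ?case
  proof (cases "i = h")
    case True
    then show ?thesis using Suc.prems by (simp add: nth_append length_row_major)
  next
    case False
    then show ?thesis using Suc row_major_less[of i h j w 0] by (simp add: nth_append length_row_major)
  qed
qed simp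

text \<open>The farthest-point rule only inspects weights of indices below \<open>n\<close>, which
  is where the memory agrees with \<open>W\<close>.\<close>

lemma greedy_set_cong:
  assumes "greedy_set w n T" "0 < n" "\<And>i j. i < n \<Longrightarrow> j < n \<Longrightarrow> w i j = w' i j"
  shows "greedy_set w' n T"
  using assms(1)
proof induction
  case (add T m)
  have "T \<subseteq> {..<n}"
    using greedy_set_props[OF add.hyps(1) \<open>0 < n\<close>] by blast
  then have "(\<lambda>q. w q m') ` T = (\<lambda>q. w' q m') ` T" if "m' < n" for m'
    using assms(3) that by (intro image_cong) auto
  then show ?case using add by (intro greedy_set.add) auto
qed (rule greedy_set.start)

lemma W_eq_sqdist:
  assumes R: "R \<in> carrier_mat k d" and p: "p q \<in> carrier_vec d" "p m \<in> carrier_vec d"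
    and F: "\<And>i r. i \<in> {q, m} \<Longrightarrow> r < k \<Longrightarrow> rmem s ''F'' (i * k + r) =
      1 / sqrt (real k) * (\<Sum>t<d. R $$ (r, t) * p i $ t)"
  shows "W R p q m = sqdist s k q m"
proof -
  have "proj R (p i) $ r = rmem s ''F'' (i * k + r)" if "i \<in> {q, m}" "r < k" for i r
    using that R p F[OF that] by (auto simp: proj_def scalar_prod_def lessThan_atLeast0)
  moreover have "dim_vec (proj R x) = k" for x using R by (simp add: proj_def)
  ultimately show ?thesis
    by (simp add: W_def Let_def scalar_prod_def sqdist_def lessThan_atLeast0 power2_eq_square)
qed

lemma runs_dimred_ham_center:
  assumes input: "dimred_input n d l p \<delta> R s" and R: "R \<in> carrier_mat (target_dim c n \<delta>) d"
    and p: "\<And>i. i < n \<Longrightarrow> p i \<in> carrier_vec d" and l: "0 < l" "l < n" and pos: "0 < target_dim c n \<delta>" "0 < d"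
  shows "runs (dimred_ham_center c) s (322 * n * target_dim c n \<delta> * (d + l))
    (\<lambda>s'. dimred_result l s' \<in> dimred_outputs n l p R)"
proof -
  define k where "k = target_dim c n \<delta>"
  let ?T1 = "13 * k + 24" and ?T2 = "21 * (k * d) + 21 * k + 9" and ?T3 = "n * (k * (36 * d + 42) + 21) + 9"
    and ?T4 = "n * 16 + 9 + (n * (43 * k + 29) + 23) + ((l - 1) * (43 * (n * k) + 71 * n + 42) + 6)"
  have R: "R \<in> carrier_mat k d" using R by (simp add: k_def)
  have coins: "coins s = concat (map (\<lambda>i. map (\<lambda>j. R $$ (i, j)) [0..<d]) [0..<k])"
    and s: "nmem s ''n'' 0 = n" "nmem s ''d'' 0 = d" "nmem s ''l'' 0 = l" "rmem s ''delta'' 0 = \<delta>"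
    and P: "\<And>i j. i < n \<Longrightarrow> j < d \<Longrightarrow> rmem s ''P'' (i * d + j) = p i $ j"
    using input R by (simp_all add: dimred_input_def)
  have "runs (dimred_ham_center c) s (?T1 + (?T2 + (?T3 + ?T4)))
    (\<lambda>s'. dimred_result l s' \<in> dimred_outputs n l p R)"
    unfolding dimred_ham_center_def
  proof (rule runs_Seq_spec[OF runs_compute_k[OF s(1,4) k_def]])
    fix s1 assume s1: "frame {''k''} {''x''} s s1 \<and> nmem s1 ''k'' 0 = k \<and> coins s1 = coins s"
    then have fr1: "frame {''k''} {''x''} s s1" by blast
    have len: "length (coins s1) = k * d" using s1 coins by (simp add: length_row_major)
    show "runs (draw_matrix ;; project_points ;; first_center ;;
        While (NLess (nv ''size'') (nv ''l'')) (select_farthest ;; add_center)) s1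
        (?T1 + (?T2 + (?T3 + ?T4)) - ?T1) (\<lambda>s'. dimred_result l s' \<in> dimred_outputs n l p R)"
    proof (rule runs_Seq_spec[OF runs_draw_matrix[OF _ _ len]])
      show "nmem s1 ''k'' 0 = k" "nmem s1 ''d'' 0 = d"
        using s1 s by (simp_all add: frame_nmem[OF fr1])
      fix s2 assume s2: "frame {''r'', ''t''} {''R''} s1 s2 \<and> (\<forall>a<k * d. rmem s2 ''R'' a = coins s1 ! a)"
      then have fr2: "frame {''r'', ''t''} {''R''} s1 s2" by blast
      note fr12 = frame_nmem[OF fr1] frame_nmem[OF fr2] frame_rmem[OF fr1] frame_rmem[OF fr2]
      have R2: "rmem s2 ''R'' (r * d + t) = R $$ (r, t)" if "r < k" "t < d" for r t
      proof -
        have "r * d + t < k * d" using row_major_less[OF that, of 0] by simp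
        then have "rmem s2 ''R'' (r * d + t) = coins s ! (r * d + t)" using s1 s2 by simp
        then show ?thesis unfolding coins using nth_row_major[OF that] by simp
      qed
      show "runs (project_points ;; first_center ;;
        While (NLess (nv ''size'') (nv ''l'')) (select_farthest ;; add_center)) s2
        (?T1 + (?T2 + (?T3 + ?T4)) - ?T1 - ?T2) (\<lambda>s'. dimred_result l s' \<in> dimred_outputs n l p R)"
      proof (rule runs_Seq_spec[OF runs_project_points])
        show "nmem s2 ''n'' 0 = n" "nmem s2 ''k'' 0 = k" "nmem s2 ''d'' 0 = d"
          using s1 s by (simp_all add: fr12)
        fix s3 assume s3: "frame {''i'', ''r'', ''t''} {''y'', ''F''} s2 s3 \<and>
          (\<forall>i<n. \<forall>r<k. rmem s3 ''F'' (i * k + r) =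
            1 / sqrt (real k) * (\<Sum>t<d. rmem s2 ''R'' (r * d + t) * rmem s2 ''P'' (i * d + t)))"
        then have fr3: "frame {''i'', ''r'', ''t''} {''y'', ''F''} s2 s3" by blast
        have F3: "rmem s3 ''F'' (i * k + r) = 1 / sqrt (real k) * (\<Sum>t<d. R $$ (r, t) * p i $ t)"
          if "i < n" "r < k" for i r
          using s3 that P by (simp add: R2 fr12)
        have w: "sqdist s3 k i j = W R p i j" if "i < n" "j < n" for i j
          using that by (intro W_eq_sqdist[symmetric, OF R] p F3) auto
        have "runs (first_center ;;
          While (NLess (nv ''size'') (nv ''l'')) (select_farthest ;; add_center)) s3 ?T4 (greedy_inv n k s3 l)"
          by (rule runs_greedy) (use s1 s l in \<open>simp_all add: frame_nmem[OF fr3] fr12\<close>)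
        then show "runs (first_center ;;
          While (NLess (nv ''size'') (nv ''l'')) (select_farthest ;; add_center)) s3
          (?T1 + (?T2 + (?T3 + ?T4)) - ?T1 - ?T2 - ?T3) (\<lambda>s'. dimred_result l s' \<in> dimred_outputs n l p R)"
        proof (rule runs_mono)
          fix s4 assume "greedy_inv n k s3 l s4"
          then have "greedy_set (sqdist s3 k) n (dimred_result l s4)" "card (dimred_result l s4) = l"
            by (simp_all add: greedy_inv_def dimred_result_def chosen_def)
          then show "dimred_result l s4 \<in> dimred_outputs n l p R"
            using greedy_set_cong[of "sqdist s3 k" n _ "W R p"] w l by (simp add: dimred_outputs_def)
        qed simp
      qed simp
    qed simp
  qed simp
  \<comment> \<open>The coefficients outside the factor \<open>l - 1\<close> add up to 322, and
    their terms are at most \<open>n * k * d\<close>. Those multiplied by \<open>l - 1\<close> add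
    up to 156, with terms at most \<open>n * k * l\<close>. Writing all four parameters as
    successors leaves a comparison of coefficients.\<close>
  moreover have "?T1 + (?T2 + (?T3 + ?T4)) \<le> 322 * n * k * (d + l)"
  proof -
    obtain n' k' d' l' where "n = Suc n'" "k = Suc k'" "d = Suc d'" "l = Suc l'"
      using l pos by (metis gr0_conv_Suc k_def less_nat_zero_code not_gr_zero)
    then show ?thesis by (simp add: algebra_simps)
  qed
  ultimately show ?thesis by (simp add: k_def runs_mono)
qed

section \<open>Guarantees with high probability\<close>

text \<open>Linearity moves the difference of the points inside each row sum, and the squared
  scaling factor becomes 1/k; the tail bounds apply to this form.\<close>

lemma W_mat_eq:
  assumes "p i \<in> carrier_vec d" "p j \<in> carrier_vec d"
  shows "W (mat k d f) p i j = (\<Sum>r<k. (\<Sum>t<d. f (r, t) * (p i $ t - p j $ t))\<^sup>2) / real k"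
proof -
  have entry: "proj (mat k d f) (p i') $ r = (\<Sum>t<d. f (r, t) * p i' $ t) / sqrt (real k)"
    if "i' \<in> {i, j}" "r < k" for i' r
    using that assms by (auto simp: proj_def scalar_prod_def lessThan_atLeast0)
  have "W (mat k d f) p i j = (\<Sum>r<k. (proj (mat k d f) (p i) $ r - proj (mat k d f) (p j) $ r)\<^sup>2)"
    by (simp add: W_def Let_def scalar_prod_def lessThan_atLeast0 power2_eq_square proj_def)
  also have "\<dots> = (\<Sum>r<k. (\<Sum>t<d. f (r, t) * (p i $ t - p j $ t))\<^sup>2 / real k)"
    by (intro sum.cong refl)
      (simp add: entry power_divide sum_subtractf right_diff_distrib flip: diff_divide_distrib)
  finally show ?thesis by (simp add: sum_divide_distrib)
qed

text \<open>Coordinates in {0, 1} differ by 0 or by 1 in absolute value.\<close>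

lemma hypercube_sum_square_diff:
  assumes "x \<in> hypercube d" "y \<in> hypercube d"
  shows "(\<Sum>t<d. (x $ t - y $ t)\<^sup>2) = real (ham x y)"
proof -
  have "(\<Sum>t<d. (x $ t - y $ t)\<^sup>2) = (\<Sum>t<d. if x $ t \<noteq> y $ t then 1 else 0)"
    using assms by (intro sum.cong) (fastforce simp: hypercube_def)+
  also have "\<dots> = real (card {t. t < d \<and> x $ t \<noteq> y $ t})"
    by (simp add: sum.If_cases Int_def)
  finally show ?thesis using assms by (auto simp: ham_def hypercube_def)
qed

lemma prob_pair_distorted:
  assumes p: "p i \<in> hypercube d" "p j \<in> hypercube d" and \<delta>: "0 < \<delta>" "\<delta> \<le> 1" and k: "0 < k"
  shows "measure_pmf.prob (random_sign_matrix k d)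
      {R. \<not> ((1 - \<delta>) * real (ham (p i) (p j)) \<le> W R p i j \<and> W R p i j \<le> (1 + \<delta>) * real (ham (p i) (p j)))}
    \<le> 2 * exp (- (real k * \<delta>\<^sup>2 / 16))"
proof -
  define v where "v t = p i $ t - p j $ t" for t
  define h where "h = (\<Sum>t<d. (v t)\<^sup>2)"
  have ham: "real (ham (p i) (p j)) = h"
    unfolding h_def v_def using p by (simp add: hypercube_sum_square_diff)
  let ?S = "signs ({..<k} \<times> {..<d})"
  let ?Q = "\<lambda>f. \<Sum>r<k. (\<Sum>t<d. f (r, t) * v t)\<^sup>2"
  have W: "W (mat k d f) p i j = ?Q f / real k" for f
    unfolding v_def by (rule W_mat_eq) (use p in \<open>auto simp: hypercube_def\<close>)
  have "measure_pmf.prob (random_sign_matrix k d)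
      {R. \<not> ((1 - \<delta>) * real (ham (p i) (p j)) \<le> W R p i j \<and> W R p i j \<le> (1 + \<delta>) * real (ham (p i) (p j)))}
    = measure_pmf.prob ?S {f. \<not> ((1 - \<delta>) * h \<le> ?Q f / real k \<and> ?Q f / real k \<le> (1 + \<delta>) * h)}"
    unfolding random_sign_matrix_def by (simp add: W ham vimage_def)
  also have "\<dots> \<le> 2 * exp (- (real k * \<delta>\<^sup>2 / 16))"
  \<comment> \<open>The tail bounds require \<open>h > 0\<close>. For \<open>h = 0\<close> both the
    distance and \<open>W\<close> are exactly 0.\<close>
  proof (cases "h = 0")
    case True
    have "?Q f = 0" for f
    proof -
      have "v t = 0" if "t < d" for t
        using True that by (simp add: h_def sum_nonneg_eq_0_iff)
      then show ?thesis by simp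
    qed
    then show ?thesis using True by simp
  next
    case False
    then have h: "0 < h" by (simp add: h_def sum_nonneg order_less_le)
    have "measure_pmf.prob ?S {f. \<not> ((1 - \<delta>) * h \<le> ?Q f / real k \<and> ?Q f / real k \<le> (1 + \<delta>) * h)}
      \<le> measure_pmf.prob ?S ({f. (1 + \<delta>) * (real k * h) \<le> ?Q f} \<union> {f. ?Q f \<le> (1 - \<delta>) * (real k * h)})"
      using k by (intro measure_pmf.finite_measure_mono) (auto simp: field_simps)
    also have "\<dots> \<le> measure_pmf.prob ?S {f. (1 + \<delta>) * (real k * h) \<le> ?Q f}
        + measure_pmf.prob ?S {f. ?Q f \<le> (1 - \<delta>) * (real k * h)}"
      by (rule measure_Un_le) auto
    also have "\<dots> \<le> exp (- (real k * \<delta>\<^sup>2 / 16)) + exp (- (real k * \<delta>\<^sup>2 / 16))"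
      using prob_rows_upper_tail[of "{..<k}" "{..<d}" \<delta> v] prob_rows_lower_tail[of "{..<k}" "{..<d}" \<delta> v]
        \<delta> h by (intro add_mono) (simp_all add: h_def)
    finally show ?thesis by simp
  qed
  finally show ?thesis .
qed

text \<open>A union bound over the n^2 ordered pairs.\<close>

lemma prob_low_distortion:
  assumes p: "p ` {..<n} \<subseteq> hypercube d" and \<delta>: "0 < \<delta>" "\<delta> \<le> 1" and k: "0 < k"
  shows "1 - 2 * (real n)\<^sup>2 * exp (- (real k * \<delta>\<^sup>2 / 16))
    \<le> measure_pmf.prob (random_sign_matrix k d) {R. low_distortion \<delta> n p (W R p)}"
proof -
  let ?M = "random_sign_matrix k d"
  let ?B = "\<lambda>(i, j). {R. \<not> ((1 - \<delta>) * real (ham (p i) (p j)) \<le> W R p i j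
    \<and> W R p i j \<le> (1 + \<delta>) * real (ham (p i) (p j)))}"
  have "measure_pmf.prob ?M {R. \<not> low_distortion \<delta> n p (W R p)}
    \<le> measure_pmf.prob ?M (\<Union>ij\<in>{..<n} \<times> {..<n}. ?B ij)"
    by (intro measure_pmf.finite_measure_mono) (auto simp: low_distortion_def)
  also have "\<dots> \<le> (\<Sum>ij\<in>{..<n} \<times> {..<n}. measure_pmf.prob ?M (?B ij))"
    by (intro measure_pmf.finite_measure_subadditive_finite) auto
  also have "\<dots> \<le> (\<Sum>ij\<in>{..<n} \<times> {..<n}. 2 * exp (- (real k * \<delta>\<^sup>2 / 16)))"
  proof (rule sum_mono)
    fix ij assume "ij \<in> {..<n} \<times> {..<n}"
    then obtain i j where "ij = (i, j)" "i < n" "j < n" by auto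
    then show "measure_pmf.prob ?M (?B ij) \<le> 2 * exp (- (real k * \<delta>\<^sup>2 / 16))"
      using p \<delta> k by (simp del: de_Morgan_conj) (intro prob_pair_distorted; auto)
  qed
  also have "\<dots> = 2 * (real n)\<^sup>2 * exp (- (real k * \<delta>\<^sup>2 / 16))"
    by (simp add: power2_eq_square)
  finally have "measure_pmf.prob ?M {R. \<not> low_distortion \<delta> n p (W R p)}
    \<le> 2 * (real n)\<^sup>2 * exp (- (real k * \<delta>\<^sup>2 / 16))" .
  then show ?thesis
    using measure_pmf.prob_neg[of ?M "\<lambda>R. low_distortion \<delta> n p (W R p)"] by simp
qed

text \<open>The lower bound on \<open>c\<close> makes the exponential at most n^-(3 + \<beta>). Of
  the three spare powers of n, two cancel the number of pairs and one absorbs the factor 2, as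
  \<open>2 \<le> n\<close>.\<close>

lemma target_dim_failure_bound:
  assumes "16 * (3 + \<beta>) \<le> c" "2 \<le> n" "0 < \<delta>"
  shows "2 * (real n)\<^sup>2 * exp (- (real (target_dim c n \<delta>) * \<delta>\<^sup>2 / 16)) \<le> 1 / real n powr \<beta>"
proof -
  have n: "0 < real n" "0 < ln (real n)" using assms by auto
  have "c * ln (real n) / \<delta>\<^sup>2 \<le> real (target_dim c n \<delta>)"
    unfolding target_dim_def by linarith
  then have "c * ln (real n) \<le> real (target_dim c n \<delta>) * \<delta>\<^sup>2"
    using assms by (simp add: field_simps)
  moreover have "(16 * (3 + \<beta>)) * ln (real n) \<le> c * ln (real n)"
    using assms n by (intro mult_right_mono) auto
  ultimately have "- (real (target_dim c n \<delta>) * \<delta>\<^sup>2 / 16) \<le> - ((3 + \<beta>) * ln (real n))"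
    by (simp add: algebra_simps)
  then have "exp (- (real (target_dim c n \<delta>) * \<delta>\<^sup>2 / 16)) \<le> exp (- ((3 + \<beta>) * ln (real n)))"
    by (simp only: exp_le_cancel_iff)
  also have "\<dots> = real n powr (- (3 + \<beta>))"
    using n by (simp add: powr_def algebra_simps)
  finally have "exp (- (real (target_dim c n \<delta>) * \<delta>\<^sup>2 / 16)) \<le> real n powr (- (3 + \<beta>))" .
  then have "2 * (real n)\<^sup>2 * exp (- (real (target_dim c n \<delta>) * \<delta>\<^sup>2 / 16))
    \<le> real n * (real n)\<^sup>2 * real n powr (- (3 + \<beta>))"
    using assms by (intro mult_mono) auto
  also have "real n * (real n)\<^sup>2 = real n powr 3"
    using n by (simp add: powr_numeral power2_eq_square power3_eq_cube)
  also have "real n powr 3 * real n powr (- (3 + \<beta>)) = real n powr (3 + - (3 + \<beta>))"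
    by (rule powr_add[symmetric])
  also have "3 + - (3 + \<beta>) = - \<beta>"
    by simp
  finally show ?thesis by (simp only: powr_minus_divide)
qed

lemma target_dim_pos:
  assumes "0 < c" "2 \<le> n" "0 < \<delta>"
  shows "0 < target_dim c n \<delta>"
  using assms by (simp add: target_dim_def)

text \<open>Rounding up costs at most 1, which is absorbed because \<epsilon>^2 \<le> 1/4 \<le> ln 2
  \<le> ln n; the 25 comes from the square of \<epsilon>/5.\<close>

lemma target_dim_le:
  assumes "0 < c" "2 \<le> n" "0 < \<epsilon>" "\<epsilon> < 1 / 2"
  shows "real (target_dim c n (\<epsilon> / 5)) \<le> (25 * c + 1) * ln (real n) / \<epsilon>\<^sup>2"
proof -
  have "\<epsilon>\<^sup>2 \<le> (1 / 2)\<^sup>2" using assms by (intro power_mono) auto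
  also have "\<dots> \<le> ln 2" using ln2_ge_two_thirds by (simp add: power2_eq_square)
  also have "\<dots> \<le> ln (real n)" using assms by simp
  finally have "1 \<le> ln (real n) / \<epsilon>\<^sup>2" using assms by simp
  moreover have "0 \<le> c * ln (real n) / (\<epsilon> / 5)\<^sup>2" using assms by simp
  then have "real (target_dim c n (\<epsilon> / 5)) \<le> c * ln (real n) / (\<epsilon> / 5)\<^sup>2 + 1"
    unfolding target_dim_def by linarith
  moreover have "c * ln (real n) / (\<epsilon> / 5)\<^sup>2 = 25 * c * ln (real n) / \<epsilon>\<^sup>2"
    by (simp add: power_divide)
  ultimately show ?thesis by (simp add: add_divide_distrib algebra_simps)
qed

section \<open>Combining time bound and probability\<close>

context
  fixes c \<beta> \<epsilon> :: real and n d l :: nat and p :: "nat \<Rightarrow> real vec"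
  assumes c: "0 < c" "16 * (3 + \<beta>) \<le> c" and p: "p ` {..<n} \<subseteq> hypercube d" "inj_on p {..<n}"
    and l: "0 < l" "l < n" and \<epsilon>: "0 < \<epsilon>" "\<epsilon> < 1 / 2"
begin

lemma n_ge_2: "2 \<le> n"
  using l by simp

lemma p_carrier: "p ` {..<n} \<subseteq> carrier_vec d"
  using p(1) by (auto simp: hypercube_def)

text \<open>In dimension 0 there is a single vector, but \<open>p\<close> takes at least two
  values.\<close>

lemma d_pos: "0 < d"
proof (rule ccontr)
  assume "\<not> 0 < d"
  moreover have "p 0 \<in> carrier_vec d" "p 1 \<in> carrier_vec d" using p_carrier n_ge_2 by auto
  ultimately have "p 0 = p 1" by (intro eq_vecI) auto
  then show False using inj_onD[OF p(2), of 0 1] n_ge_2 by simp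
qed

lemma k_pos: "0 < target_dim c n (\<epsilon> / 5)"
  using c n_ge_2 \<epsilon> by (intro target_dim_pos) auto

lemma dimred_ham_center_time:
  assumes R: "R \<in> set_pmf (random_sign_matrix (target_dim c n (\<epsilon> / 5)) d)"
    and s: "dimred_input n d l p (\<epsilon> / 5) R s"
  shows "\<exists>t s'. big_step (dimred_ham_center c) s t s' \<and> dimred_result l s' \<in> dimred_outputs n l p R \<and>
    real t \<le> 322 * (25 * c + 1) * (real n * ln (real n) * (real d + real l) / \<epsilon>\<^sup>2)"
proof -
  define k where "k = target_dim c n (\<epsilon> / 5)"
  have Rk: "R \<in> carrier_mat (target_dim c n (\<epsilon> / 5)) d"
    using R by (auto simp: random_sign_matrix_def)
  have pc: "p i \<in> carrier_vec d" if "i < n" for i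
    using p_carrier that by auto
  obtain t s' where t: "big_step (dimred_ham_center c) s t s'" "t \<le> 322 * n * k * (d + l)"
      "dimred_result l s' \<in> dimred_outputs n l p R"
    using runs_dimred_ham_center[OF s Rk pc l k_pos d_pos] unfolding runs_def k_def by blast
  have rearrange: "322 * N * S * (K * L / E) = 322 * K * (N * L * S / E)" for N S K L E :: real
    by simp
  have "real t \<le> real (322 * n * k * (d + l))"
    using t(2) by (rule of_nat_mono)
  also have "\<dots> = 322 * real n * (real d + real l) * real k"
    by simp
  also have "\<dots> \<le> 322 * real n * (real d + real l) * ((25 * c + 1) * ln (real n) / \<epsilon>\<^sup>2)"
    unfolding k_def using c n_ge_2 \<epsilon> by (intro mult_left_mono target_dim_le) auto
  also have "\<dots> = 322 * (25 * c + 1) * (real n * ln (real n) * (real d + real l) / \<epsilon>\<^sup>2)"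
    by (rule rearrange)
  finally show ?thesis using t by blast
qed

text \<open>Both guarantees follow from the same event of low distortion, so monotonicity gives each
  its probability.\<close>

lemma prob_good:
  assumes "\<And>R. low_distortion (\<epsilon> / 5) n p (W R p) \<Longrightarrow> R \<in> A"
  shows "1 - 1 / real n powr \<beta> \<le> measure_pmf.prob (random_sign_matrix (target_dim c n (\<epsilon> / 5)) d) A"
proof -
  let ?M = "random_sign_matrix (target_dim c n (\<epsilon> / 5)) d"
  have \<delta>: "0 < \<epsilon> / 5" "\<epsilon> / 5 \<le> 1" using \<epsilon> by auto
  have "1 - 1 / real n powr \<beta> \<le> measure_pmf.prob ?M {R. low_distortion (\<epsilon> / 5) n p (W R p)}"
    using prob_low_distortion[OF p(1) \<delta> k_pos] target_dim_failure_bound[OF c(2) n_ge_2 \<delta>(1)]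
    by linarith
  also have "\<dots> \<le> measure_pmf.prob ?M A"
    using assms by (intro measure_pmf.finite_measure_mono) auto
  finally show ?thesis .
qed

lemma center_guarantee:
  assumes R: "low_distortion (\<epsilon> / 5) n p (W R p)" and T: "T \<in> dimred_outputs n l p R"
  shows "p ` T \<subseteq> p ` {..<n} \<and> card (p ` T) = l \<and>
    real (center_cost (p ` {..<n}) (p ` T)) \<le> (2 + \<epsilon>) * real (opt_center d l (p ` {..<n}))"
proof -
  note out = output_props[OF p_carrier p(2) l \<epsilon> R T]
  have "card (p ` T) = l"
    using out(2) inj_on_subset[OF p(2) out(3)] by (simp add: card_image)
  then show ?thesis
    using out(3) output_center_cost[OF p_carrier p(2) l \<epsilon> R T] by blast
qed

lemma diameter_guarantee:
  assumes R: "low_distortion (\<epsilon> / 5) n p (W R p)" and T: "T \<in> dimred_outputs n l p R"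
    and a: "nearest_assignment n p R T a"
  shows "partition_on (p ` {..<n}) (clusters n p T a) \<and> card (clusters n p T a) = l \<and>
    real (max_diameter (clusters n p T a)) \<le> (2 + \<epsilon>) * real (opt_diam l (p ` {..<n}))"
  using partition_on_clusters[OF p_carrier p(2) l \<epsilon> R T a] card_clusters[OF p_carrier p(2) l \<epsilon> R T a]
    output_diameter[OF p_carrier p(2) l \<epsilon> R T a] by blast

end

theorem theorem2:
  fixes \<beta> :: real
  assumes "\<beta> \<ge> 1"
  shows "\<exists>c0>0. \<forall>c\<ge>c0. \<exists>C>0.
    \<forall>(n::nat) (d::nat) (l::nat) (p::nat \<Rightarrow> real vec) (\<epsilon>::real).
      p ` {..<n} \<subseteq> hypercube d \<and> inj_on p {..<n} \<and> 0 < l \<and> l < n \<and> 0 < \<epsilon> \<and> \<epsilon> < 1 / 2 \<longrightarrow>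
      (let P = p ` {..<n};
           \<delta> = \<epsilon> / 5;
           M = random_sign_matrix (target_dim c n \<delta>) d
       in (\<forall>R \<in> set_pmf M. \<forall>s. dimred_input n d l p \<delta> R s \<longrightarrow>
             (\<exists>t s'. big_step (dimred_ham_center c) s t s' \<and>
                dimred_result l s' \<in> dimred_outputs n l p R \<and>
                real t \<le> C * (real n * ln (real n) * (real d + real l) / \<epsilon>\<^sup>2))) \<and>
          measure_pmf.prob M
            {R. \<forall>T \<in> dimred_outputs n l p R.
                  p ` T \<subseteq> P \<and> card (p ` T) = l \<and>
                  real (center_cost P (p ` T)) \<le> (2 + \<epsilon>) * real (opt_center d l P)}
            \<ge> 1 - 1 / real n powr \<beta> \<and>
          measure_pmf.prob M
            {R. \<forall>T \<in> dimred_outputs n l p R. \<forall>a. nearest_assignment n p R T a \<longrightarrow>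
                  partition_on P (clusters n p T a) \<and> card (clusters n p T a) = l \<and>
                  real (max_diameter (clusters n p T a)) \<le> (2 + \<epsilon>) * real (opt_diam l P)}
            \<ge> 1 - 1 / real n powr \<beta>)"
  \<comment> \<open>The threshold on \<open>c\<close> required by
    \<open>target_dim_failure_bound\<close>.\<close>
  apply (rule exI[of _ "16 * (3 + \<beta>)"], rule conjI)
  subgoal using assms by simp
  apply (intro allI impI)
  subgoal premises c for c
  proof -
    have c0: "0 < c" by (rule less_le_trans[OF _ c]) (use assms in simp)
    show ?thesis
      \<comment> \<open>The factor 322 comes from the step count and \<open>25 * c + 1\<close> from
        the size of the target dimension.\<close>
      apply (rule exI[of _ "322 * (25 * c + 1)"], rule conjI)
      subgoal using c0 by simp
      apply (intro allI impI)
      subgoal premises prems for n d l p \<epsilon>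
      proof -
        have p: "p ` {..<n} \<subseteq> hypercube d" "inj_on p {..<n}" and l: "0 < l" "l < n"
          and \<epsilon>: "0 < \<epsilon>" "\<epsilon> < 1 / 2"
          using prems by auto
        show ?thesis
          unfolding Let_def
        proof (intro conjI ballI allI impI)
          fix R s
          assume "R \<in> set_pmf (random_sign_matrix (target_dim c n (\<epsilon> / 5)) d)"
            "dimred_input n d l p (\<epsilon> / 5) R s"
          then show "\<exists>t s'. big_step (dimred_ham_center c) s t s' \<and>
              dimred_result l s' \<in> dimred_outputs n l p R \<and>
              real t \<le> 322 * (25 * c + 1) * (real n * ln (real n) * (real d + real l) / \<epsilon>\<^sup>2)"
            by (rule dimred_ham_center_time[OF c0 c p l \<epsilon>])
        qed (intro prob_good[OF c0 c p l \<epsilon>] CollectI ballI allI impI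
            center_guarantee[OF c0 c p l \<epsilon>] diameter_guarantee[OF c0 c p l \<epsilon>]; assumption)+
      qed
      done
  qed
  done

end
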